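(* Let $\mathcal{C}$ be a topos equipped with a cartesian double factorization system $(\mathcal{E},\mathcal{J},\mathcal{M})$ generating a Lawvere–Tierney topology $k$, and with a cartesian comonad $\mathbb{G}=(G,\epsilon,\delta)$ such that $G$ is $(k,k)$-continuous, $G(\mathcal{M})\subseteq\mathcal{M}$ and $G(\mathcal{J})\subseteq\mathcal{J}$. Then the Lawvere–Tierney topology $k_{\mathbb{G}}$ generated by the left-induced cartesian double factorization system $(\mathcal{E}_{\mathbb{G}},\mathcal{J}_{\mathbb{G}},\mathcal{M}_{\mathbb{G}})$ on the topos of coalgebras $\mathcal{C}_{\mathbb{G}}$ equals the extension $\widetilde{k}$ of the Lawvere–Tierney topology $k$.
   Context: Topos means elementary topos. $\mathrm{true}\colon 1\rightarrowtail\Omega$ is the subobject classifier, $\mathrm{char}\,m$ the characteristic morphism of a monomorphism. For classes of morphisms, $\mathcal{B}\cdot\mathcal{A}$ is the class of composites $ba$ with $a\in\mathcal{A}$, $b\in\mathcal{B}$. A double factorization system (dfs) on a category is a triple $(\mathcal{E},\mathcal{J},\mathcal{M})$ of classes of morphisms such that: (1) $\mathrm{Iso}\cdot\mathcal{E}\subseteq\mathcal{E}$, $\mathrm{Iso}\cdot\mathcal{J}\cdot\mathrm{Iso}\subseteq\mathcal{J}$, $\mathcal{M}\cdot\mathrm{Iso}\subseteq\mathcal{M}$; (2) every morphism lies in $\mathcal{M}\cdot\mathcal{J}\cdot\mathcal{E}$; (3) for $e\colon A\to B$ in $\mathcal{E}$, $j\colon B\to C$ and $j'\colon D\to E$ in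 $\mathcal{J}$, $m\colon E\to F$ in $\mathcal{M}$ and $u\colon A\to D$, $v\colon C\to F$ with $vje=mj'u$, there is a unique pair $s\colon B\to D$, $t\colon C\to E$ with $se=u$, $j's=tj$, $mt=v$. It is cartesian (on a topos) if $\mathcal{E}$ and $\mathcal{J}\cdot\mathcal{E}$ are stable under pullback and $\mathcal{M}\cdot\mathcal{J}\subseteq\mathrm{Mono}$. A Lawvere–Tierney topology is $k\colon\Omega\to\Omega$ with $kk=k$, $k\,\mathrm{true}=\mathrm{true}$, $k\wedge=\wedge(k\times k)$, where $\wedge=\mathrm{char}(\mathrm{true}\times\mathrm{true})$. The Lawvere–Tierney topology generated by a cartesian dfs is $\mathrm{char}\,m$, where $\mathrm{true}=mje$ with $e\in\mathcal{E}$, $j\in\mathcal{J}$, $m\in\mathcal{M}$. The universal closure operator of $k$ is $c(m)\simeq(k\,\mathrm{char}\,m)^*(\mathrm{true})$ on subobjects; for an arbitrary morphism $f$ with codomain $B$, $c_B(f)$ denotes the closure of the image of $f$. The functor $G$ is $(k,k)$-continuous if $G(c_B(f))\le c_{GB}(G(f))$ for every object $B$ and every morphism $f$ with codomain $B$. A comonad $\mathbb{G}$ is cartesian if $G$ preserves finite limits; then the category $\mathcal{C}_{\mathbb{G}}$ of Eilenberg–Moore coalgebras is a topos. $G_{\mathbb{G}}\colon\mathcal{C}_{\mathbb{G}}\to\mathcal{C}$ is the forgetful functor. The left-induced dfs on $\mathcal{C}_{\mathbb{G}}$ is $\mathcal{E}_{\mathbb{G}}=G_{\mathbb{G}}^{-1}(\mathcal{E})$,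 $\mathcal{J}_{\mathbb{G}}=G_{\mathbb{G}}^{-1}(\mathcal{J})$, $\mathcal{M}_{\mathbb{G}}=G_{\mathbb{G}}^{-1}(\mathcal{M})$ (under the stated hypotheses it is a cartesian dfs). Let $\tau=\mathrm{char}(G(\mathrm{true}))\colon G\Omega\to\Omega$, and let $m_{\mathbb{G}}\colon\Omega_{\mathbb{G}}\to G\Omega$ be the equalizer of $1_{G\Omega}$ and $G(\tau)\delta_{\Omega}$ in $\mathcal{C}$. These arrows are coalgebra morphisms and $m_{\mathbb{G}}$ is also their equalizer $(\Omega_{\mathbb{G}},\omega)\to(G\Omega,\delta_{\Omega})$ in $\mathcal{C}_{\mathbb{G}}$. The subobject classifier $\mathrm{true}_{\mathbb{G}}$ of $\mathcal{C}_{\mathbb{G}}$, with values in $(\Omega_{\mathbb{G}},\omega)$, is the unique arrow with $m_{\mathbb{G}}\mathrm{true}_{\mathbb{G}}=G(\mathrm{true})$. The extension of $k$ is the unique coalgebra morphism $\widetilde{k}\colon(\Omega_{\mathbb{G}},\omega)\to(\Omega_{\mathbb{G}},\omega)$ with $m_{\mathbb{G}}\widetilde{k}=G(k)m_{\mathbb{G}}$. *)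

theory Defs
  imports Main
begin

record ('o, 'a) precategory =
  Obj :: "'o set"
  Arr :: "'a set"
  Dom :: "'a \<Rightarrow> 'o"
  Cod :: "'a \<Rightarrow> 'o"
  Id :: "'o \<Rightarrow> 'a"
  Comp :: "'a \<Rightarrow> 'a \<Rightarrow> 'a" (infixl \<open>\<cdot>\<index>\<close> 70)

definition Hom :: "('o, 'a) precategory \<Rightarrow> 'o \<Rightarrow> 'o \<Rightarrow> 'a set" where
  "Hom C A B = {f \<in> Arr C. Dom C f = A \<and> Cod C f = B}"

locale category =
  fixes C :: "('o, 'a) precategory" (structure)
  assumes Dom_in_Obj: "f \<in> Arr C \<Longrightarrow> Dom C f \<in> Obj C"
    and Cod_in_Obj: "f \<in> Arr C \<Longrightarrow> Cod C f \<in> Obj C"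
    and Id_in_Hom: "A \<in> Obj C \<Longrightarrow> Id C A \<in> Hom C A A"
    and Comp_in_Hom: "\<lbrakk>f \<in> Hom C A B; g \<in> Hom C B D\<rbrakk> \<Longrightarrow> g \<cdot> f \<in> Hom C A D"
    and Comp_assoc: "\<lbrakk>f \<in> Hom C A B; g \<in> Hom C B D; h \<in> Hom C D E\<rbrakk>
      \<Longrightarrow> (h \<cdot> g) \<cdot> f = h \<cdot> (g \<cdot> f)"
    and Comp_Id_right: "f \<in> Hom C A B \<Longrightarrow> f \<cdot> Id C A = f"
    and Comp_Id_left: "f \<in> Hom C A B \<Longrightarrow> Id C B \<cdot> f = f"

record ('o, 'a, 'p, 'b) functor_data =
  ObjMap :: "'o \<Rightarrow> 'p"
  ArrMap :: "'a \<Rightarrow> 'b"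

locale cat_functor = source: category C + target: category D
  for C :: "('o, 'a) precategory" and D :: "('p, 'b) precategory" +
  fixes F :: "('o, 'a, 'p, 'b) functor_data"
  assumes ObjMap_in_Obj: "A \<in> Obj C \<Longrightarrow> ObjMap F A \<in> Obj D"
    and ArrMap_in_Hom: "f \<in> Hom C A B \<Longrightarrow> ArrMap F f \<in> Hom D (ObjMap F A) (ObjMap F B)"
    and ArrMap_Id: "A \<in> Obj C \<Longrightarrow> ArrMap F (Id C A) = Id D (ObjMap F A)"
    and ArrMap_Comp: "\<lbrakk>f \<in> Hom C A B; g \<in> Hom C B E\<rbrakk>
      \<Longrightarrow> ArrMap F (g \<cdot>\<^bsub>C\<^esub> f) = ArrMap F g \<cdot>\<^bsub>D\<^esub> ArrMap F f"

definition functor_comp ::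
    "('p, 'b, 'q, 'c) functor_data \<Rightarrow> ('o, 'a, 'p, 'b) functor_data \<Rightarrow> ('o, 'a, 'q, 'c) functor_data" where
  "functor_comp G F = \<lparr>ObjMap = ObjMap G \<circ> ObjMap F, ArrMap = ArrMap G \<circ> ArrMap F\<rparr>"

definition mono_arr :: "('o, 'a) precategory \<Rightarrow> 'a \<Rightarrow> bool" where
  "mono_arr C m \<longleftrightarrow> m \<in> Arr C \<and>
     (\<forall>X. \<forall>f \<in> Hom C X (Dom C m). \<forall>g \<in> Hom C X (Dom C m). m \<cdot>\<^bsub>C\<^esub> f = m \<cdot>\<^bsub>C\<^esub> g \<longrightarrow> f = g)"

definition iso_arr :: "('o, 'a) precategory \<Rightarrow> 'a \<Rightarrow> bool" where
  "iso_arr C f \<longleftrightarrow> f \<in> Arr C \<and>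
     (\<exists>g \<in> Hom C (Cod C f) (Dom C f).
        g \<cdot>\<^bsub>C\<^esub> f = Id C (Dom C f) \<and> f \<cdot>\<^bsub>C\<^esub> g = Id C (Cod C f))"

definition is_cone ::
    "('i, 'e) precategory \<Rightarrow> ('o, 'a) precategory \<Rightarrow> ('i, 'e, 'o, 'a) functor_data
      \<Rightarrow> 'o \<Rightarrow> ('i \<Rightarrow> 'a) \<Rightarrow> bool" where
  "is_cone I C D X l \<longleftrightarrow> X \<in> Obj C \<and> (\<forall>i \<in> Obj I. l i \<in> Hom C X (ObjMap D i)) \<and>
     (\<forall>u \<in> Arr I. ArrMap D u \<cdot>\<^bsub>C\<^esub> l (Dom I u) = l (Cod I u))"

definition is_limit ::
    "('i, 'e) precategory \<Rightarrow> ('o, 'a) precategory \<Rightarrow> ('i, 'e, 'o, 'a) functor_data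
      \<Rightarrow> 'o \<Rightarrow> ('i \<Rightarrow> 'a) \<Rightarrow> bool" where
  "is_limit I C D X l \<longleftrightarrow> is_cone I C D X l \<and>
     (\<forall>Y l'. is_cone I C D Y l' \<longrightarrow>
        (\<exists>!h. h \<in> Hom C Y X \<and> (\<forall>i \<in> Obj I. l i \<cdot>\<^bsub>C\<^esub> h = l' i)))"

text \<open>Up to isomorphism, every finite category has natural numbers as objects and arrows.\<close>

definition finite_shape :: "(nat, nat) precategory \<Rightarrow> bool" where
  "finite_shape I \<longleftrightarrow> category I \<and> finite (Obj I) \<and> finite (Arr I)"

definition has_finite_limits :: "('o, 'a) precategory \<Rightarrow> bool" where
  "has_finite_limits C \<longleftrightarrow>
     (\<forall>I D. finite_shape I \<and> cat_functor I C D \<longrightarrow> (\<exists>X l. is_limit I C D X l))"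

definition preserves_finite_limits ::
    "('o, 'a) precategory \<Rightarrow> ('p, 'b) precategory \<Rightarrow> ('o, 'a, 'p, 'b) functor_data \<Rightarrow> bool" where
  "preserves_finite_limits C D F \<longleftrightarrow>
     (\<forall>I K X l. finite_shape I \<and> cat_functor I C K \<and> is_limit I C K X l \<longrightarrow>
        is_limit I D (functor_comp F K) (ObjMap F X) (ArrMap F \<circ> l))"

definition terminal_obj :: "('o, 'a) precategory \<Rightarrow> 'o \<Rightarrow> bool" where
  "terminal_obj C T \<longleftrightarrow> T \<in> Obj C \<and> (\<forall>X \<in> Obj C. \<exists>!h. h \<in> Hom C X T)"

definition is_product :: "('o, 'a) precategory \<Rightarrow> 'o \<Rightarrow> 'o \<Rightarrow> 'a \<Rightarrow> 'a \<Rightarrow> bool" where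
  "is_product C A B p q \<longleftrightarrow> p \<in> Hom C (Dom C p) A \<and> q \<in> Hom C (Dom C p) B \<and>
     (\<forall>X. \<forall>f \<in> Hom C X A. \<forall>g \<in> Hom C X B.
        \<exists>!h. h \<in> Hom C X (Dom C p) \<and> p \<cdot>\<^bsub>C\<^esub> h = f \<and> q \<cdot>\<^bsub>C\<^esub> h = g)"

text \<open>\<open>h\<close> is the arrow \<open>f \<times> g\<close> from the product with projections \<open>r, s\<close>
  to the product with projections \<open>p, q\<close>.\<close>

definition is_product_arr ::
    "('o, 'a) precategory \<Rightarrow> 'a \<Rightarrow> 'a \<Rightarrow> 'a \<Rightarrow> 'a \<Rightarrow> 'a \<Rightarrow> 'a \<Rightarrow> 'a \<Rightarrow> bool" where
  "is_product_arr C r s p q f g h \<longleftrightarrow>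
     h \<in> Hom C (Dom C r) (Dom C p) \<and> p \<cdot>\<^bsub>C\<^esub> h = f \<cdot>\<^bsub>C\<^esub> r \<and> q \<cdot>\<^bsub>C\<^esub> h = g \<cdot>\<^bsub>C\<^esub> s"

definition is_equalizer :: "('o, 'a) precategory \<Rightarrow> 'a \<Rightarrow> 'a \<Rightarrow> 'a \<Rightarrow> bool" where
  "is_equalizer C f g m \<longleftrightarrow> f \<in> Arr C \<and> g \<in> Hom C (Dom C f) (Cod C f) \<and>
     m \<in> Hom C (Dom C m) (Dom C f) \<and> f \<cdot>\<^bsub>C\<^esub> m = g \<cdot>\<^bsub>C\<^esub> m \<and>
     (\<forall>X. \<forall>x \<in> Hom C X (Dom C f). f \<cdot>\<^bsub>C\<^esub> x = g \<cdot>\<^bsub>C\<^esub> x \<longrightarrow>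
        (\<exists>!h. h \<in> Hom C X (Dom C m) \<and> m \<cdot>\<^bsub>C\<^esub> h = x))"

text \<open>The square \<open>f p = g q\<close> is a pullback, so \<open>p\<close> is the pullback of \<open>g\<close> along \<open>f\<close>
  and \<open>q\<close> is the pullback of \<open>f\<close> along \<open>g\<close>.\<close>

definition is_pullback :: "('o, 'a) precategory \<Rightarrow> 'a \<Rightarrow> 'a \<Rightarrow> 'a \<Rightarrow> 'a \<Rightarrow> bool" where
  "is_pullback C f g p q \<longleftrightarrow> f \<in> Arr C \<and> g \<in> Hom C (Dom C g) (Cod C f) \<and>
     p \<in> Hom C (Dom C p) (Dom C f) \<and> q \<in> Hom C (Dom C p) (Dom C g) \<and>
     f \<cdot>\<^bsub>C\<^esub> p = g \<cdot>\<^bsub>C\<^esub> q \<and>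
     (\<forall>X. \<forall>x \<in> Hom C X (Dom C f). \<forall>y \<in> Hom C X (Dom C g). f \<cdot>\<^bsub>C\<^esub> x = g \<cdot>\<^bsub>C\<^esub> y \<longrightarrow>
        (\<exists>!h. h \<in> Hom C X (Dom C p) \<and> p \<cdot>\<^bsub>C\<^esub> h = x \<and> q \<cdot>\<^bsub>C\<^esub> h = y))"

definition is_exponential ::
    "('o, 'a) precategory \<Rightarrow> 'o \<Rightarrow> 'o \<Rightarrow> 'o \<Rightarrow> 'a \<Rightarrow> 'a \<Rightarrow> 'a \<Rightarrow> bool" where
  "is_exponential C A B E p q ev \<longleftrightarrow> is_product C E A p q \<and> ev \<in> Hom C (Dom C p) B \<and>
     (\<forall>X r s. \<forall>f \<in> Hom C (Dom C r) B. is_product C X A r s \<longrightarrow>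
        (\<exists>!h. h \<in> Hom C X E \<and>
          (\<exists>w. is_product_arr C r s p q h (Id C A) w \<and> ev \<cdot>\<^bsub>C\<^esub> w = f)))"

definition cartesian_closed :: "('o, 'a) precategory \<Rightarrow> bool" where
  "cartesian_closed C \<longleftrightarrow> (\<exists>T. terminal_obj C T) \<and>
     (\<forall>A \<in> Obj C. \<forall>B \<in> Obj C. \<exists>p q. is_product C A B p q) \<and>
     (\<forall>A \<in> Obj C. \<forall>B \<in> Obj C. \<exists>E p q ev. is_exponential C A B E p q ev)"

text \<open>With \<open>t\<close> the arrow \<open>true\<close>, \<open>is_char C t m \<chi>\<close> says that \<open>\<chi> = char m\<close>,
  i.e. that \<open>m\<close> is \<open>\<chi>\<^sup>*(true)\<close>.\<close>

definition is_char :: "('o, 'a) precategory \<Rightarrow> 'a \<Rightarrow> 'a \<Rightarrow> 'a \<Rightarrow> bool" where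
  "is_char C t m \<chi> \<longleftrightarrow> (\<exists>q. is_pullback C \<chi> t m q)"

definition subobject_classifier :: "('o, 'a) precategory \<Rightarrow> 'a \<Rightarrow> bool" where
  "subobject_classifier C t \<longleftrightarrow> t \<in> Arr C \<and> terminal_obj C (Dom C t) \<and>
     (\<forall>m. mono_arr C m \<longrightarrow> (\<exists>!\<chi>. is_char C t m \<chi>))"

definition topos :: "('o, 'a) precategory \<Rightarrow> bool" where
  "topos C \<longleftrightarrow> category C \<and> has_finite_limits C \<and> cartesian_closed C \<and>
     (\<exists>t. subobject_classifier C t)"

text \<open>\<open>w\<close> is \<open>\<and> = char (true \<times> true)\<close>, on the product \<open>\<Omega> \<times> \<Omega>\<close> with projections \<open>p, q\<close>.\<close>

definition is_meet :: "('o, 'a) precategory \<Rightarrow> 'a \<Rightarrow> 'a \<Rightarrow> 'a \<Rightarrow> 'a \<Rightarrow> bool" where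
  "is_meet C t p q w \<longleftrightarrow> is_product C (Cod C t) (Cod C t) p q \<and>
     (\<exists>r s tt. is_product C (Dom C t) (Dom C t) r s \<and> is_product_arr C r s p q t t tt \<and>
        is_char C t tt w)"

definition lawvere_tierney :: "('o, 'a) precategory \<Rightarrow> 'a \<Rightarrow> 'a \<Rightarrow> bool" where
  "lawvere_tierney C t k \<longleftrightarrow> k \<in> Hom C (Cod C t) (Cod C t) \<and>
     k \<cdot>\<^bsub>C\<^esub> k = k \<and> k \<cdot>\<^bsub>C\<^esub> t = t \<and>
     (\<forall>p q w kk. is_meet C t p q w \<and> is_product_arr C p q p q k k kk \<longrightarrow>
        k \<cdot>\<^bsub>C\<^esub> w = w \<cdot>\<^bsub>C\<^esub> kk)"

definition sub_le :: "('o, 'a) precategory \<Rightarrow> 'a \<Rightarrow> 'a \<Rightarrow> bool" where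
  "sub_le C m n \<longleftrightarrow> m \<in> Arr C \<and> n \<in> Arr C \<and>
     (\<exists>h \<in> Hom C (Dom C m) (Dom C n). m = n \<cdot>\<^bsub>C\<^esub> h)"

text \<open>The closure of \<open>m\<close> is \<open>(k char m)\<^sup>*(true)\<close>, and the closure of an
  arbitrary arrow is that of its image. Images, closures, characteristic arrows and limits are only
  determined up to isomorphism or exist only in suitable categories, hence the relational style.\<close>

definition is_image :: "('o, 'a) precategory \<Rightarrow> 'a \<Rightarrow> 'a \<Rightarrow> bool" where
  "is_image C f m \<longleftrightarrow> mono_arr C m \<and> sub_le C f m \<and>
     (\<forall>n. mono_arr C n \<and> sub_le C f n \<longrightarrow> sub_le C m n)"

definition is_closure :: "('o, 'a) precategory \<Rightarrow> 'a \<Rightarrow> 'a \<Rightarrow> 'a \<Rightarrow> 'a \<Rightarrow> bool" where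
  "is_closure C t k m c \<longleftrightarrow> mono_arr C m \<and>
     (\<exists>\<chi>. is_char C t m \<chi> \<and> is_char C t c (k \<cdot>\<^bsub>C\<^esub> \<chi>))"

definition is_closure_of_arr :: "('o, 'a) precategory \<Rightarrow> 'a \<Rightarrow> 'a \<Rightarrow> 'a \<Rightarrow> 'a \<Rightarrow> bool" where
  "is_closure_of_arr C t k f c \<longleftrightarrow> (\<exists>m. is_image C f m \<and> is_closure C t k m c)"

definition continuous_functor ::
    "('o, 'a) precategory \<Rightarrow> 'a \<Rightarrow> 'a \<Rightarrow> ('o, 'a, 'o, 'a) functor_data \<Rightarrow> bool" where
  "continuous_functor C t k G \<longleftrightarrow>
     (\<forall>f \<in> Arr C. \<forall>c c'. is_closure_of_arr C t k f c \<and> is_closure_of_arr C t k (ArrMap G f) c' \<longrightarrow>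
        sub_le C (ArrMap G c) c')"

definition class_comp :: "('o, 'a) precategory \<Rightarrow> 'a set \<Rightarrow> 'a set \<Rightarrow> 'a set" where
  "class_comp C \<B> \<A> = {b \<cdot>\<^bsub>C\<^esub> a | a b. a \<in> \<A> \<and> b \<in> \<B> \<and> Dom C b = Cod C a}"

definition pullback_stable :: "('o, 'a) precategory \<Rightarrow> 'a set \<Rightarrow> bool" where
  "pullback_stable C \<A> \<longleftrightarrow> (\<forall>f \<in> \<A>. \<forall>g p q. is_pullback C f g p q \<longrightarrow> q \<in> \<A>)"

locale double_factorization_system = category C
  for C :: "('o, 'a) precategory" (structure) +
  fixes \<E> \<J> \<M> :: "'a set"
  assumes E_arr: "\<E> \<subseteq> Arr C" and J_arr: "\<J> \<subseteq> Arr C" and M_arr: "\<M> \<subseteq> Arr C"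
    and Iso_E: "class_comp C (Collect (iso_arr C)) \<E> \<subseteq> \<E>"
    and Iso_J_Iso:
      "class_comp C (Collect (iso_arr C)) (class_comp C \<J> (Collect (iso_arr C))) \<subseteq> \<J>"
    and M_Iso: "class_comp C \<M> (Collect (iso_arr C)) \<subseteq> \<M>"
    and factorization: "Arr C \<subseteq> class_comp C \<M> (class_comp C \<J> \<E>)"
    and diagonal:
      "\<lbrakk>e \<in> \<E>; e \<in> Hom C A B; j \<in> \<J>; j \<in> Hom C B X; j' \<in> \<J>; j' \<in> Hom C D Y;
        m \<in> \<M>; m \<in> Hom C Y F; u \<in> Hom C A D; v \<in> Hom C X F; v \<cdot> (j \<cdot> e) = m \<cdot> (j' \<cdot> u)\<rbrakk>
       \<Longrightarrow> \<exists>!(s, t). s \<in> Hom C B D \<and> t \<in> Hom C X Y \<and> s \<cdot> e = u \<and> j' \<cdot> s = t \<cdot> j \<and> m \<cdot> t = v"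

locale cartesian_dfs = double_factorization_system +
  assumes E_stable: "pullback_stable C \<E>"
    and JE_stable: "pullback_stable C (class_comp C \<J> \<E>)"
    and MJ_mono: "class_comp C \<M> \<J> \<subseteq> Collect (mono_arr C)"

text \<open>The generated topology is \<open>char m\<close> for any factorization \<open>true = m j e\<close>; on a topos
  with a cartesian double factorization system the first conjunct is a consequence of the second.\<close>

definition generates_topology ::
    "('o, 'a) precategory \<Rightarrow> 'a \<Rightarrow> 'a set \<Rightarrow> 'a set \<Rightarrow> 'a set \<Rightarrow> 'a \<Rightarrow> bool" where
  "generates_topology C t \<E> \<J> \<M> k \<longleftrightarrow> lawvere_tierney C t k \<and>
     (\<exists>e \<in> \<E>. \<exists>j \<in> \<J>. \<exists>m \<in> \<M>. Dom C j = Cod C e \<and> Dom C m = Cod C j \<and>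
        t = m \<cdot>\<^bsub>C\<^esub> (j \<cdot>\<^bsub>C\<^esub> e) \<and> is_char C t m k)"

locale comonad = cat_functor C C G
  for C :: "('o, 'a) precategory" (structure) and G :: "('o, 'a, 'o, 'a) functor_data" +
  fixes \<epsilon> \<delta> :: "'o \<Rightarrow> 'a"
  assumes counit_in_Hom: "A \<in> Obj C \<Longrightarrow> \<epsilon> A \<in> Hom C (ObjMap G A) A"
    and comult_in_Hom: "A \<in> Obj C \<Longrightarrow> \<delta> A \<in> Hom C (ObjMap G A) (ObjMap G (ObjMap G A))"
    and counit_natural: "f \<in> Hom C A B \<Longrightarrow> \<epsilon> B \<cdot> ArrMap G f = f \<cdot> \<epsilon> A"
    and comult_natural: "f \<in> Hom C A B \<Longrightarrow> \<delta> B \<cdot> ArrMap G f = ArrMap G (ArrMap G f) \<cdot> \<delta> A"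
    and counit_left: "A \<in> Obj C \<Longrightarrow> \<epsilon> (ObjMap G A) \<cdot> \<delta> A = Id C (ObjMap G A)"
    and counit_right: "A \<in> Obj C \<Longrightarrow> ArrMap G (\<epsilon> A) \<cdot> \<delta> A = Id C (ObjMap G A)"
    and coassociative: "A \<in> Obj C \<Longrightarrow> \<delta> (ObjMap G A) \<cdot> \<delta> A = ArrMap G (\<delta> A) \<cdot> \<delta> A"

locale cartesian_comonad = comonad +
  assumes preserves: "preserves_finite_limits C C G"

text \<open>A coalgebra is a pair \<open>(A, \<alpha>)\<close>; a coalgebra morphism carries its domain and codomain,
  since the underlying arrow does not determine the coalgebra structures.\<close>

type_synonym ('o, 'a) coalg_arr = "('o \<times> 'a) \<times> 'a \<times> ('o \<times> 'a)"

definition is_coalgebra ::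
    "('o, 'a) precategory \<Rightarrow> ('o, 'a, 'o, 'a) functor_data \<Rightarrow> ('o \<Rightarrow> 'a) \<Rightarrow> ('o \<Rightarrow> 'a)
      \<Rightarrow> 'o \<times> 'a \<Rightarrow> bool" where
  "is_coalgebra C G \<epsilon> \<delta> = (\<lambda>(A, \<alpha>). A \<in> Obj C \<and> \<alpha> \<in> Hom C A (ObjMap G A) \<and>
     \<epsilon> A \<cdot>\<^bsub>C\<^esub> \<alpha> = Id C A \<and> \<delta> A \<cdot>\<^bsub>C\<^esub> \<alpha> = ArrMap G \<alpha> \<cdot>\<^bsub>C\<^esub> \<alpha>)"

definition Coalg ::
    "('o, 'a) precategory \<Rightarrow> ('o, 'a, 'o, 'a) functor_data \<Rightarrow> ('o \<Rightarrow> 'a) \<Rightarrow> ('o \<Rightarrow> 'a)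
      \<Rightarrow> ('o \<times> 'a, ('o, 'a) coalg_arr) precategory" where
  "Coalg C G \<epsilon> \<delta> = \<lparr>
     Obj = Collect (is_coalgebra C G \<epsilon> \<delta>),
     Arr = {((A, \<alpha>), f, (B, \<beta>)) | A \<alpha> f B \<beta>.
       is_coalgebra C G \<epsilon> \<delta> (A, \<alpha>) \<and> is_coalgebra C G \<epsilon> \<delta> (B, \<beta>) \<and>
       f \<in> Hom C A B \<and> \<beta> \<cdot>\<^bsub>C\<^esub> f = ArrMap G f \<cdot>\<^bsub>C\<^esub> \<alpha>},
     Dom = (\<lambda>(X, f, Y). X),
     Cod = (\<lambda>(X, f, Y). Y),
     Id = (\<lambda>X. (X, Id C (fst X), X)),
     Comp = (\<lambda>(Y, g, Z) (X, f, Y'). (X, g \<cdot>\<^bsub>C\<^esub> f, Z))\<rparr>"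

definition Forget :: "('o \<times> 'a, ('o, 'a) coalg_arr, 'o, 'a) functor_data" where
  "Forget = \<lparr>ObjMap = (\<lambda>(A, \<alpha>). A), ArrMap = (\<lambda>(X, f, Y). f)\<rparr>"

definition cofree ::
    "('o, 'a, 'o, 'a) functor_data \<Rightarrow> ('o \<Rightarrow> 'a) \<Rightarrow> 'o \<Rightarrow> 'o \<times> 'a" where
  "cofree G \<delta> A = (ObjMap G A, \<delta> A)"

definition left_induced ::
    "('o, 'a) precategory \<Rightarrow> ('o, 'a, 'o, 'a) functor_data \<Rightarrow> ('o \<Rightarrow> 'a) \<Rightarrow> ('o \<Rightarrow> 'a)
      \<Rightarrow> 'a set \<Rightarrow> ('o, 'a) coalg_arr set" where
  "left_induced C G \<epsilon> \<delta> \<A> = {f \<in> Arr (Coalg C G \<epsilon> \<delta>). ArrMap Forget f \<in> \<A>}"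

text \<open>The coalgebra morphism \<open>m\<close> from \<open>(\<Omega>\<^sub>G, \<omega>)\<close> to \<open>(G \<Omega>, \<delta>\<^bsub>\<Omega>\<^esub>)\<close> is the
  equalizer of \<open>1\<close> and \<open>G(\<tau>) \<delta>\<^bsub>\<Omega>\<^esub>\<close> in \<open>C\<close>, where \<open>\<tau> = char (G true)\<close>.\<close>

definition is_coalg_omega ::
    "('o, 'a) precategory \<Rightarrow> ('o, 'a, 'o, 'a) functor_data \<Rightarrow> ('o \<Rightarrow> 'a) \<Rightarrow> ('o \<Rightarrow> 'a)
      \<Rightarrow> 'a \<Rightarrow> ('o, 'a) coalg_arr \<Rightarrow> bool" where
  "is_coalg_omega C G \<epsilon> \<delta> t m \<longleftrightarrow>
     m \<in> Arr (Coalg C G \<epsilon> \<delta>) \<and> Cod (Coalg C G \<epsilon> \<delta>) m = cofree G \<delta> (Cod C t) \<and>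
     (\<exists>\<tau>. is_char C t (ArrMap G t) \<tau> \<and>
        is_equalizer C (Id C (ObjMap G (Cod C t))) (ArrMap G \<tau> \<cdot>\<^bsub>C\<^esub> \<delta> (Cod C t)) (ArrMap Forget m))"

definition is_coalg_true ::
    "('o, 'a) precategory \<Rightarrow> ('o, 'a, 'o, 'a) functor_data \<Rightarrow> ('o \<Rightarrow> 'a) \<Rightarrow> ('o \<Rightarrow> 'a)
      \<Rightarrow> 'a \<Rightarrow> ('o, 'a) coalg_arr \<Rightarrow> ('o, 'a) coalg_arr \<Rightarrow> bool" where
  "is_coalg_true C G \<epsilon> \<delta> t m t\<^sub>G \<longleftrightarrow>
     t\<^sub>G \<in> Hom (Coalg C G \<epsilon> \<delta>) (cofree G \<delta> (Dom C t)) (Dom (Coalg C G \<epsilon> \<delta>) m) \<and>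
     ArrMap Forget m \<cdot>\<^bsub>C\<^esub> ArrMap Forget t\<^sub>G = ArrMap G t"

definition is_extension ::
    "('o, 'a) precategory \<Rightarrow> ('o, 'a, 'o, 'a) functor_data \<Rightarrow> ('o \<Rightarrow> 'a) \<Rightarrow> ('o \<Rightarrow> 'a)
      \<Rightarrow> ('o, 'a) coalg_arr \<Rightarrow> 'a \<Rightarrow> ('o, 'a) coalg_arr \<Rightarrow> bool" where
  "is_extension C G \<epsilon> \<delta> m k k' \<longleftrightarrow>
     k' \<in> Hom (Coalg C G \<epsilon> \<delta>) (Dom (Coalg C G \<epsilon> \<delta>) m) (Dom (Coalg C G \<epsilon> \<delta>) m) \<and>
     ArrMap Forget m \<cdot>\<^bsub>C\<^esub> ArrMap Forget k' = ArrMap G k \<cdot>\<^bsub>C\<^esub> ArrMap Forget m"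

lemma (in comonad) category_Coalg: "category (Coalg C G \<epsilon> \<delta>)"
proof -
  let ?D = "Coalg C G \<epsilon> \<delta>"
  have H: "Hom ?D X Y = {(X, f, Y) | f. is_coalgebra C G \<epsilon> \<delta> X \<and> is_coalgebra C G \<epsilon> \<delta> Y \<and>
       f \<in> Hom C (fst X) (fst Y) \<and> snd Y \<cdot> f = ArrMap G f \<cdot> snd X}" for X Y
    unfolding Hom_def Coalg_def by (cases X; cases Y) auto
  have coalg: "fst X \<in> Obj C" "snd X \<in> Hom C (fst X) (ObjMap G (fst X))"
    if "is_coalgebra C G \<epsilon> \<delta> X" for X
    using that by (auto simp: is_coalgebra_def)
  show ?thesis
  proof
    show "Dom ?D f \<in> Obj ?D" "Cod ?D f \<in> Obj ?D" if "f \<in> Arr ?D" for f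
      using that by (auto simp: Coalg_def)
    show "Id ?D A \<in> Hom ?D A A" if "A \<in> Obj ?D" for A
    proof -
      have c: "is_coalgebra C G \<epsilon> \<delta> A" using that by (simp add: Coalg_def)
      have "snd A \<cdot> Id C (fst A) = ArrMap G (Id C (fst A)) \<cdot> snd A"
        using coalg[OF c] by (simp add: ArrMap_Id source.Comp_Id_left source.Comp_Id_right)
      then show ?thesis
        unfolding H using c coalg[OF c] source.Id_in_Hom by (simp add: Coalg_def)
    qed
    show "g \<cdot>\<^bsub>?D\<^esub> f \<in> Hom ?D A E" if "f \<in> Hom ?D A B" "g \<in> Hom ?D B E" for f g A B E
    proof -
      obtain f' g' where f: "f = (A, f', B)" "f' \<in> Hom C (fst A) (fst B)"
          "snd B \<cdot> f' = ArrMap G f' \<cdot> snd A" "is_coalgebra C G \<epsilon> \<delta> A" "is_coalgebra C G \<epsilon> \<delta> B"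
        and g: "g = (B, g', E)" "g' \<in> Hom C (fst B) (fst E)"
          "snd E \<cdot> g' = ArrMap G g' \<cdot> snd B" "is_coalgebra C G \<epsilon> \<delta> E"
        using \<open>f \<in> Hom ?D A B\<close> \<open>g \<in> Hom ?D B E\<close> unfolding H by blast
      note a = f(2) g(2) coalg(2)[OF f(4)] coalg(2)[OF f(5)] coalg(2)[OF g(4)]
        ArrMap_in_Hom[OF f(2)] ArrMap_in_Hom[OF g(2)]
      have "snd E \<cdot> (g' \<cdot> f') = (ArrMap G g' \<cdot> snd B) \<cdot> f'"
        using source.Comp_assoc[OF a(1,2,5)] g(3) by simp
      also have "\<dots> = ArrMap G g' \<cdot> (ArrMap G f' \<cdot> snd A)"
        using source.Comp_assoc[OF a(1,4,7)] f(3) by simp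
      also have "\<dots> = ArrMap G (g' \<cdot> f') \<cdot> snd A"
        using source.Comp_assoc[OF a(3,6,7)] ArrMap_Comp[OF a(1,2)] by simp
      finally show ?thesis
        unfolding H using f g source.Comp_in_Hom[OF a(1,2)] by (simp add: Coalg_def)
    qed
    show "(h \<cdot>\<^bsub>?D\<^esub> g) \<cdot>\<^bsub>?D\<^esub> f = h \<cdot>\<^bsub>?D\<^esub> (g \<cdot>\<^bsub>?D\<^esub> f)"
      if "f \<in> Hom ?D A B" "g \<in> Hom ?D B E" "h \<in> Hom ?D E F" for f g h A B E F
      using that source.Comp_assoc unfolding H by (auto simp: Coalg_def)
    show "f \<cdot>\<^bsub>?D\<^esub> Id ?D A = f" "Id ?D B \<cdot>\<^bsub>?D\<^esub> f = f" if "f \<in> Hom ?D A B" for f A B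
      using that source.Comp_Id_left source.Comp_Id_right unfolding H by (auto simp: Coalg_def)
  qed
qed

end

theory Submission
  imports Defs
begin

text \<open>In \<open>C\<close>, the closure of a subobject \<open>n = m j e\<close> is \<open>m\<close>. Applied to \<open>true\<close> and \<open>G(true)\<close>,
  continuity of \<open>G\<close> and \<open>G(\<M>) \<subseteq> \<M>\<close> give \<open>k \<tau> = \<tau> G(k)\<close>. Put \<open>\<phi> = \<tau> m\<^sub>G : \<Omega>\<^sub>G \<rightarrow> \<Omega>\<close>.
  Then \<open>\<phi>\<close> is the characteristic arrow in \<open>C\<close> of the arrow underlying \<open>true\<^sub>G\<close>, composition with \<open>\<phi>\<close>
  is injective on coalgebra morphisms into \<open>\<Omega>\<^sub>G\<close>, and the extension \<open>k'\<close> satisfies \<open>\<phi> k' = k \<phi>\<close>.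
  The forgetful functor preserves and reflects pullbacks, so every statement about characteristic
  arrows of coalgebras can be tested in \<open>C\<close> after composing with \<open>\<phi>\<close>: if \<open>true\<^sub>G = m j e\<close> then
  \<open>m\<close> has characteristic arrow \<open>k \<phi> = \<phi> k'\<close> in \<open>C\<close>, hence \<open>k'\<close> in coalgebras.\<close>

section \<open>Pullbacks and products\<close>

text \<open>The obstacle is that nothing is assumed about G on \<E>: if
  \<open>true = m0 j0 e0\<close>, then \<open>G(m0) G(j0) G(e0)\<close> need not be a factorization
  of \<open>G(true)\<close>, so \<open>G(m0)\<close> is not at once the closure of
  \<open>G(true)\<close>. It is squeezed instead. Diagonals into \<open>G(j0)\<close>,
  \<open>G(m0)\<close> show that the closure lies below \<open>G(m0)\<close>, and continuity gives
  the reverse inequality. Preservation of \<J> and \<M> returns when factorizations are lifted to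
  coalgebras: diagonals against \<open>G(j)\<close>, \<open>G(m)\<close> provide structure maps on
  the two intermediate objects, and uniqueness of diagonals against \<open>j\<close>,
  \<open>m\<close> and against \<open>G(G(j))\<close>, \<open>G(G(m))\<close> forces the coalgebra
  axioms. Since a generated topology must satisfy the Lawvere-Tierney equations, these have to be
  checked for \<open>k'\<close>. Each becomes the corresponding equation for \<open>k\<close> after
  composition with \<open>\<phi>\<close>; the meet also needs products of coalgebras to be products
  in \<open>C\<close>, which is why products are treated as pullbacks over a terminal
  object.\<close>

declare Hom_def [simp]

context category
begin

section \<open>Composition as rewriting with side conditions on domains and codomains\<close>

lemma comp_arr [simp]:
  assumes "f \<in> Arr C" "g \<in> Arr C" "Dom C g = Cod C f"
  shows "g \<cdot> f \<in> Arr C" "Dom C (g \<cdot> f) = Dom C f" "Cod C (g \<cdot> f) = Cod C g"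
  using Comp_in_Hom[of f "Dom C f" "Cod C f" g "Cod C g"] assms by auto

lemma comp_assoc [simp]:
  assumes "f \<in> Arr C" "g \<in> Arr C" "h \<in> Arr C" "Dom C g = Cod C f" "Dom C h = Cod C g"
  shows "(h \<cdot> g) \<cdot> f = h \<cdot> (g \<cdot> f)"
  using Comp_assoc[of f "Dom C f" "Cod C f" g "Cod C g" h "Cod C h"] assms by auto

lemma id_arr [simp]:
  assumes "A \<in> Obj C"
  shows "Id C A \<in> Arr C" "Dom C (Id C A) = A" "Cod C (Id C A) = A"
  using Id_in_Hom[OF assms] by auto

lemma dom_cod_obj [simp]: "f \<in> Arr C \<Longrightarrow> Dom C f \<in> Obj C" "f \<in> Arr C \<Longrightarrow> Cod C f \<in> Obj C"
  by (auto intro: Dom_in_Obj Cod_in_Obj)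

lemma comp_id [simp]:
  assumes "f \<in> Arr C"
  shows "Dom C f = A \<Longrightarrow> f \<cdot> Id C A = f" "Cod C f = B \<Longrightarrow> Id C B \<cdot> f = f"
  using Comp_Id_right[of f "Dom C f" "Cod C f"] Comp_Id_left[of f "Dom C f" "Cod C f"] assms by auto

text \<open>Simplification brackets composites to the right, which hides the factor
  \<open>a \<cdot> b\<close> inside \<open>a \<cdot> (b \<cdot> x)\<close>. This form lets a
  commuting square be used in front of a further arrow.\<close>

lemma comp_reassoc:
  assumes "a \<cdot> b = c \<cdot> d" "a \<in> Arr C" "b \<in> Arr C" "c \<in> Arr C" "d \<in> Arr C" "x \<in> Arr C"
    "Dom C a = Cod C b" "Dom C c = Cod C d" "Dom C b = Cod C x" "Dom C d = Cod C x"
  shows "a \<cdot> (b \<cdot> x) = c \<cdot> (d \<cdot> x)"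
  using comp_assoc[of x b a] comp_assoc[of x d c] assms by simp

lemma comp_reassoc1:
  assumes "a \<cdot> b = c" "a \<in> Arr C" "b \<in> Arr C" "x \<in> Arr C"
    "Dom C a = Cod C b" "Dom C b = Cod C x"
  shows "a \<cdot> (b \<cdot> x) = c \<cdot> x"
  using comp_assoc[of x b a] assms by simp

lemma mono_cancel:
  assumes "mono_arr C m" "m \<cdot> f = m \<cdot> g" "f \<in> Arr C" "g \<in> Arr C" "Dom C f = Dom C g"
    "Cod C f = Dom C m" "Cod C g = Dom C m"
  shows "f = g"
  using assms unfolding mono_arr_def by fastforce

lemma mono_arrI:
  assumes "m \<in> Arr C"
    "\<And>f g. \<lbrakk>f \<in> Arr C; g \<in> Arr C; Dom C f = Dom C g; Cod C f = Dom C m; Cod C g = Dom C m;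
      m \<cdot> f = m \<cdot> g\<rbrakk> \<Longrightarrow> f = g"
  shows "mono_arr C m"
  using assms unfolding mono_arr_def by auto

lemma terminal_eq:
  assumes "terminal_obj C T" "f \<in> Arr C" "g \<in> Arr C" "Dom C f = Dom C g" "Cod C f = T" "Cod C g = T"
  shows "f = g"
proof -
  have "f \<in> Hom C (Dom C f) T" "g \<in> Hom C (Dom C f) T" "Dom C f \<in> Obj C" using assms by auto
  then show ?thesis using assms(1) unfolding terminal_obj_def by blast
qed

lemma terminal_arr:
  assumes "terminal_obj C T" "X \<in> Obj C"
  obtains h where "h \<in> Arr C" "Dom C h = X" "Cod C h = T"
  using assms unfolding terminal_obj_def by auto

lemma terminal_mono:
  assumes "terminal_obj C (Dom C t)" "t \<in> Arr C"
  shows "mono_arr C t"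
  using terminal_eq[OF assms(1)] assms(2) by (auto intro!: mono_arrI)

section \<open>Pullback squares: pasting, cancellation, change of representative\<close>

lemma pullback_arr:
  assumes "is_pullback C f g p q"
  shows "f \<in> Arr C" "g \<in> Arr C" "p \<in> Arr C" "q \<in> Arr C" "Cod C g = Cod C f"
    "Cod C p = Dom C f" "Cod C q = Dom C g" "Dom C q = Dom C p" "f \<cdot> p = g \<cdot> q"
  using assms unfolding is_pullback_def by auto

lemma pullback_lift:
  assumes "is_pullback C f g p q" "x \<in> Arr C" "y \<in> Arr C" "Dom C x = Dom C y"
    "Cod C x = Dom C f" "Cod C y = Dom C g" "f \<cdot> x = g \<cdot> y"
  obtains h where "h \<in> Arr C" "Dom C h = Dom C x" "Cod C h = Dom C p" "p \<cdot> h = x" "q \<cdot> h = y"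
proof -
  have "x \<in> Hom C (Dom C x) (Dom C f)" "y \<in> Hom C (Dom C x) (Dom C g)"
    using assms by auto
  then obtain h where "h \<in> Hom C (Dom C x) (Dom C p) \<and> p \<cdot> h = x \<and> q \<cdot> h = y"
    using assms(1,7) unfolding is_pullback_def by blast
  then show thesis using that by auto
qed

lemma pullback_eq:
  assumes "is_pullback C f g p q" "h \<in> Arr C" "h' \<in> Arr C" "Dom C h = Dom C h'"
    "Cod C h = Dom C p" "Cod C h' = Dom C p" "p \<cdot> h = p \<cdot> h'" "q \<cdot> h = q \<cdot> h'"
  shows "h = h'"
proof -
  note a = pullback_arr[OF assms(1)]
  have "p \<cdot> h \<in> Hom C (Dom C h) (Dom C f)" "q \<cdot> h \<in> Hom C (Dom C h) (Dom C g)"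
    using a assms by auto
  moreover have "f \<cdot> (p \<cdot> h) = g \<cdot> (q \<cdot> h)"
    by (rule comp_reassoc) (use a assms in auto)
  ultimately have "\<exists>!z. z \<in> Hom C (Dom C h) (Dom C p) \<and> p \<cdot> z = p \<cdot> h \<and> q \<cdot> z = q \<cdot> h"
    using assms(1) unfolding is_pullback_def by blast
  moreover have "h \<in> Hom C (Dom C h) (Dom C p)" "h' \<in> Hom C (Dom C h) (Dom C p)"
    using assms by auto
  ultimately show ?thesis using assms(7,8) by metis
qed

lemma is_pullbackI:
  assumes "f \<in> Arr C" "g \<in> Arr C" "p \<in> Arr C" "q \<in> Arr C" "Cod C g = Cod C f"
    "Cod C p = Dom C f" "Cod C q = Dom C g" "Dom C q = Dom C p" "f \<cdot> p = g \<cdot> q"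
    and ex: "\<And>x y. \<lbrakk>x \<in> Arr C; y \<in> Arr C; Dom C y = Dom C x; Cod C x = Dom C f; Cod C y = Dom C g;
      f \<cdot> x = g \<cdot> y\<rbrakk> \<Longrightarrow> \<exists>h \<in> Hom C (Dom C x) (Dom C p). p \<cdot> h = x \<and> q \<cdot> h = y"
    and eq: "\<And>h h'. \<lbrakk>h \<in> Arr C; h' \<in> Arr C; Dom C h' = Dom C h; Cod C h = Dom C p;
      Cod C h' = Dom C p; p \<cdot> h = p \<cdot> h'; q \<cdot> h = q \<cdot> h'\<rbrakk> \<Longrightarrow> h = h'"
  shows "is_pullback C f g p q"
proof -
  have lift: "\<exists>!h. h \<in> Hom C X (Dom C p) \<and> p \<cdot> h = x \<and> q \<cdot> h = y"
    if xy: "x \<in> Hom C X (Dom C f)" "y \<in> Hom C X (Dom C g)" "f \<cdot> x = g \<cdot> y" for X x y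
  proof -
    have X: "Dom C x = X" using xy by simp
    have "\<exists>h \<in> Hom C (Dom C x) (Dom C p). p \<cdot> h = x \<and> q \<cdot> h = y"
      by (rule ex) (use xy in simp_all)
    then obtain h where h: "h \<in> Hom C X (Dom C p)" "p \<cdot> h = x" "q \<cdot> h = y"
      unfolding X by blast
    show ?thesis
    proof (rule ex1I[of _ h])
      fix h' assume "h' \<in> Hom C X (Dom C p) \<and> p \<cdot> h' = x \<and> q \<cdot> h' = y"
      then show "h' = h" using h by - (rule eq, simp_all)
    qed (use h in simp)
  qed
  show ?thesis unfolding is_pullback_def
  proof (intro conjI allI ballI impI)
    fix X x y assume "x \<in> Hom C X (Dom C f)" "y \<in> Hom C X (Dom C g)" "f \<cdot> x = g \<cdot> y"
    then show "\<exists>!h. h \<in> Hom C X (Dom C p) \<and> p \<cdot> h = x \<and> q \<cdot> h = y"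
      by (rule lift)
  qed (simp_all add: assms(1-9))
qed

lemma pullback_mono:
  assumes "is_pullback C f g p q" "mono_arr C g"
  shows "mono_arr C p"
proof (rule mono_arrI)
  note a = pullback_arr[OF assms(1)]
  show "p \<in> Arr C" by (fact a)
  fix h h' assume h: "h \<in> Arr C" "h' \<in> Arr C" "Dom C h = Dom C h'"
    "Cod C h = Dom C p" "Cod C h' = Dom C p" "p \<cdot> h = p \<cdot> h'"
  have "g \<cdot> (q \<cdot> h) = f \<cdot> (p \<cdot> h)"
    by (rule comp_reassoc) (use a h in auto)
  also have "\<dots> = g \<cdot> (q \<cdot> h')"
    unfolding h(6) by (rule comp_reassoc) (use a h in auto)
  finally have "q \<cdot> h = q \<cdot> h'"
    using mono_cancel[OF assms(2)] a h by auto
  then show "h = h'" using pullback_eq[OF assms(1)] h by auto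
qed

lemma pullback_paste:
  assumes "is_pullback C f g p q" "is_pullback C h p r s"
  shows "is_pullback C (f \<cdot> h) g r (q \<cdot> s)"
proof (rule is_pullbackI)
  note a = pullback_arr[OF assms(1)] pullback_arr[OF assms(2)]
  show "(f \<cdot> h) \<cdot> r = g \<cdot> (q \<cdot> s)"
    using a comp_reassoc[OF a(9), of s] by simp
  show "\<exists>z \<in> Hom C (Dom C x) (Dom C r). r \<cdot> z = x \<and> (q \<cdot> s) \<cdot> z = y"
    if xy: "x \<in> Arr C" "y \<in> Arr C" "Dom C y = Dom C x" "Cod C x = Dom C (f \<cdot> h)" "Cod C y = Dom C g"
      "(f \<cdot> h) \<cdot> x = g \<cdot> y" for x y
  proof -
    obtain u where u: "u \<in> Arr C" "Dom C u = Dom C x" "Cod C u = Dom C p" "p \<cdot> u = h \<cdot> x" "q \<cdot> u = y"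
      by (rule pullback_lift[OF assms(1), of "h \<cdot> x" y]) (use a xy in auto)
    obtain z where z: "z \<in> Arr C" "Dom C z = Dom C x" "Cod C z = Dom C r" "r \<cdot> z = x" "s \<cdot> z = u"
      by (rule pullback_lift[OF assms(2), of x u]) (use a xy u in auto)
    then show ?thesis using a u by (intro bexI[of _ z]) auto
  qed
  show "z = z'" if z: "z \<in> Arr C" "z' \<in> Arr C" "Dom C z' = Dom C z" "Cod C z = Dom C r"
      "Cod C z' = Dom C r" "r \<cdot> z = r \<cdot> z'" "(q \<cdot> s) \<cdot> z = (q \<cdot> s) \<cdot> z'" for z z'
  proof (rule pullback_eq[OF assms(2)])
    show "s \<cdot> z = s \<cdot> z'"
    proof (rule pullback_eq[OF assms(1)])
      show "p \<cdot> (s \<cdot> z) = p \<cdot> (s \<cdot> z')"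
        using comp_reassoc[OF a(18), of z] comp_reassoc[OF a(18), of z'] z a by simp
    qed (use a z in auto)
  qed (use z in auto)
qed (use pullback_arr[OF assms(1)] pullback_arr[OF assms(2)] in auto)

lemma pullback_iso:
  assumes "is_pullback C f g p q" "h \<in> Arr C" "h' \<in> Arr C" "Dom C h = Cod C h'" "Dom C h' = Cod C h"
    "Cod C h = Dom C p" "h \<cdot> h' = Id C (Cod C h)" "h' \<cdot> h = Id C (Dom C h)"
  shows "is_pullback C f g (p \<cdot> h) (q \<cdot> h)"
proof (rule is_pullbackI)
  note a = pullback_arr[OF assms(1)]
  show "f \<cdot> (p \<cdot> h) = g \<cdot> (q \<cdot> h)" by (rule comp_reassoc) (use a assms in auto)
  show "\<exists>z \<in> Hom C (Dom C x) (Dom C (p \<cdot> h)). (p \<cdot> h) \<cdot> z = x \<and> (q \<cdot> h) \<cdot> z = y"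
    if xy: "x \<in> Arr C" "y \<in> Arr C" "Dom C y = Dom C x" "Cod C x = Dom C f" "Cod C y = Dom C g"
      "f \<cdot> x = g \<cdot> y" for x y
  proof -
    obtain u where u: "u \<in> Arr C" "Dom C u = Dom C x" "Cod C u = Dom C p" "p \<cdot> u = x" "q \<cdot> u = y"
      by (rule pullback_lift[OF assms(1), of x y]) (use a xy in auto)
    have "h \<cdot> (h' \<cdot> u) = u" using comp_reassoc1[OF assms(7), of u] u assms by auto
    then show ?thesis using a u assms by (intro bexI[of _ "h' \<cdot> u"]) auto
  qed
  show "z = z'" if z: "z \<in> Arr C" "z' \<in> Arr C" "Dom C z' = Dom C z" "Cod C z = Dom C (p \<cdot> h)"
      "Cod C z' = Dom C (p \<cdot> h)" "(p \<cdot> h) \<cdot> z = (p \<cdot> h) \<cdot> z'" "(q \<cdot> h) \<cdot> z = (q \<cdot> h) \<cdot> z'" for z z'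
  proof -
    have "h \<cdot> z = h \<cdot> z'"
      by (rule pullback_eq[OF assms(1)]) (use a z assms in auto)
    then have "h' \<cdot> (h \<cdot> z) = h' \<cdot> (h \<cdot> z')" by simp
    then show ?thesis using comp_reassoc1[OF assms(8), of z] comp_reassoc1[OF assms(8), of z'] z a assms
      by auto
  qed
qed (use pullback_arr[OF assms(1)] assms in auto)

lemma pullbacks_iso:
  assumes "is_pullback C f g p q" "is_pullback C f g p' q'"
  obtains h h' where "h \<in> Arr C" "h' \<in> Arr C" "Dom C h = Cod C h'" "Dom C h' = Cod C h"
    "Cod C h = Dom C p" "h \<cdot> h' = Id C (Cod C h)" "h' \<cdot> h = Id C (Dom C h)"
    "p \<cdot> h = p'" "q \<cdot> h = q'"
proof -
  note a = pullback_arr[OF assms(1)] pullback_arr[OF assms(2)]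
  obtain h where h: "h \<in> Arr C" "Dom C h = Dom C p'" "Cod C h = Dom C p" "p \<cdot> h = p'" "q \<cdot> h = q'"
    by (rule pullback_lift[OF assms(1), of p' q']) (use a in auto)
  obtain h' where h': "h' \<in> Arr C" "Dom C h' = Dom C p" "Cod C h' = Dom C p'" "p' \<cdot> h' = p" "q' \<cdot> h' = q"
    by (rule pullback_lift[OF assms(2), of p q]) (use a in auto)
  have "h \<cdot> h' = Id C (Dom C p)"
    by (rule pullback_eq[OF assms(1)])
      (use a h h' comp_reassoc1[OF h(4), of h'] comp_reassoc1[OF h(5), of h'] in auto)
  moreover have "h' \<cdot> h = Id C (Dom C p')"
    by (rule pullback_eq[OF assms(2)])
      (use a h h' comp_reassoc1[OF h'(4), of h] comp_reassoc1[OF h'(5), of h] in auto)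
  ultimately show thesis using that[of h h'] h h' by auto
qed

section \<open>Binary products and products of arrows\<close>

lemma product_arr:
  assumes "is_product C A B p q"
  shows "p \<in> Arr C" "q \<in> Arr C" "Dom C q = Dom C p" "Cod C p = A" "Cod C q = B"
  using assms unfolding is_product_def by auto

lemma product_lift:
  assumes "is_product C A B p q" "f \<in> Arr C" "g \<in> Arr C" "Cod C f = A" "Cod C g = B" "Dom C g = Dom C f"
  obtains h where "h \<in> Arr C" "Dom C h = Dom C f" "Cod C h = Dom C p" "p \<cdot> h = f" "q \<cdot> h = g"
proof -
  have "f \<in> Hom C (Dom C f) A" "g \<in> Hom C (Dom C f) B" using assms by auto
  then obtain h where "h \<in> Hom C (Dom C f) (Dom C p) \<and> p \<cdot> h = f \<and> q \<cdot> h = g"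
    using assms(1) unfolding is_product_def by blast
  then show thesis using that by auto
qed

lemma product_eq:
  assumes "is_product C A B p q" "h \<in> Arr C" "h' \<in> Arr C" "Dom C h = Dom C h'"
    "Cod C h = Dom C p" "Cod C h' = Dom C p" "p \<cdot> h = p \<cdot> h'" "q \<cdot> h = q \<cdot> h'"
  shows "h = h'"
proof -
  note a = product_arr[OF assms(1)]
  have "p \<cdot> h \<in> Hom C (Dom C h) A" "q \<cdot> h \<in> Hom C (Dom C h) B"
    using a assms by auto
  then have "\<exists>!z. z \<in> Hom C (Dom C h) (Dom C p) \<and> p \<cdot> z = p \<cdot> h \<and> q \<cdot> z = q \<cdot> h"
    using assms(1) unfolding is_product_def by blast
  moreover have "h \<in> Hom C (Dom C h) (Dom C p)" "h' \<in> Hom C (Dom C h) (Dom C p)"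
    using assms by auto
  ultimately show ?thesis using assms(7,8) by metis
qed

text \<open>Two arrows into a terminal object always form a commuting square, so the two universal
  properties coincide. Through this, results on pullbacks of coalgebras yield results on their
  products.\<close>

lemma product_iff_pullback:
  assumes T: "terminal_obj C T" and ab: "a \<in> Hom C A T" "b \<in> Hom C B T"
  shows "is_product C A B p q \<longleftrightarrow> is_pullback C a b p q"
proof
  assume P: "is_product C A B p q"
  note [simp] = product_arr[OF P]
  have ab' [simp]: "a \<in> Arr C" "b \<in> Arr C" "Dom C a = A" "Dom C b = B" "Cod C a = T" "Cod C b = T"
    using ab by simp_all
  have e: "a \<cdot> p = b \<cdot> q" by (rule terminal_eq[OF T]) simp_all
  show "is_pullback C a b p q"
  proof (rule is_pullbackI)
    fix x y assume "x \<in> Arr C" "y \<in> Arr C" "Dom C y = Dom C x" "Cod C x = Dom C a" "Cod C y = Dom C b"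
    then obtain h where "h \<in> Arr C" "Dom C h = Dom C x" "Cod C h = Dom C p" "p \<cdot> h = x" "q \<cdot> h = y"
      using product_lift[OF P, of x y] by auto
    then show "\<exists>h \<in> Hom C (Dom C x) (Dom C p). p \<cdot> h = x \<and> q \<cdot> h = y" by auto
  next
    fix h h' assume "h \<in> Arr C" "h' \<in> Arr C" "Dom C h' = Dom C h" "Cod C h = Dom C p"
      "Cod C h' = Dom C p" "p \<cdot> h = p \<cdot> h'" "q \<cdot> h = q \<cdot> h'"
    then show "h = h'" by (intro product_eq[OF P, of h h']) simp_all
  qed (simp_all add: e)
next
  assume P: "is_pullback C a b p q"
  have ab' [simp]: "a \<in> Arr C" "b \<in> Arr C" "Dom C a = A" "Dom C b = B" "Cod C a = T" "Cod C b = T"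
    using ab by simp_all
  show "is_product C A B p q"
    unfolding is_product_def
  proof (intro conjI allI ballI)
    fix X f g assume fg: "f \<in> Hom C X A" "g \<in> Hom C X B"
    have "a \<cdot> f = b \<cdot> g" by (rule terminal_eq[OF T]) (use fg in simp_all)
    moreover have "\<forall>X. \<forall>x \<in> Hom C X A. \<forall>y \<in> Hom C X B. a \<cdot> x = b \<cdot> y \<longrightarrow>
        (\<exists>!h. h \<in> Hom C X (Dom C p) \<and> p \<cdot> h = x \<and> q \<cdot> h = y)"
      using P unfolding is_pullback_def ab' by blast
    ultimately show "\<exists>!h. h \<in> Hom C X (Dom C p) \<and> p \<cdot> h = f \<and> q \<cdot> h = g"
      using fg by blast
  qed (simp_all add: pullback_arr[OF P])
qed

lemma product_arr_arr:
  assumes "is_product_arr C r s p q f g h"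
  shows "h \<in> Arr C" "Dom C h = Dom C r" "Cod C h = Dom C p" "p \<cdot> h = f \<cdot> r" "q \<cdot> h = g \<cdot> s"
  using assms unfolding is_product_arr_def by auto

lemma product_arr_ex:
  assumes "is_product C A B p q" "is_product C A' B' r s" "f \<in> Hom C A' A" "g \<in> Hom C B' B"
  obtains h where "is_product_arr C r s p q f g h"
proof -
  note a = product_arr[OF assms(1)] product_arr[OF assms(2)]
  obtain h where "h \<in> Arr C" "Dom C h = Dom C (f \<cdot> r)" "Cod C h = Dom C p" "p \<cdot> h = f \<cdot> r" "q \<cdot> h = g \<cdot> s"
    by (rule product_lift[OF assms(1), of "f \<cdot> r" "g \<cdot> s"]) (use a assms in auto)
  then show thesis using a assms by (intro that) (auto simp: is_product_arr_def)
qed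

text \<open>Limits commute with limits: a compatible pair over the product square splits into two
  compatible pairs over the original square, and the two lifts are paired again. It serves to
  compute \<open>char (true \<times> true)\<close> on coalgebras from the one in
  \<open>C\<close>.\<close>

lemma pullback_product:
  assumes P: "is_pullback C f g a b"
    and prods: "is_product C (Dom C f) (Dom C f) f\<^sub>1 f\<^sub>2" "is_product C (Cod C f) (Cod C f) c\<^sub>1 c\<^sub>2"
      "is_product C (Dom C g) (Dom C g) g\<^sub>1 g\<^sub>2" "is_product C (Dom C a) (Dom C a) a\<^sub>1 a\<^sub>2"
    and arrs: "is_product_arr C f\<^sub>1 f\<^sub>2 c\<^sub>1 c\<^sub>2 f f ff" "is_product_arr C g\<^sub>1 g\<^sub>2 c\<^sub>1 c\<^sub>2 g g gg"
      "is_product_arr C a\<^sub>1 a\<^sub>2 f\<^sub>1 f\<^sub>2 a a aa" "is_product_arr C a\<^sub>1 a\<^sub>2 g\<^sub>1 g\<^sub>2 b b bb"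
  shows "is_pullback C ff gg aa bb"
proof -
  note h [simp] = pullback_arr[OF P] product_arr[OF prods(1)] product_arr[OF prods(2)] product_arr[OF prods(3)]
    product_arr[OF prods(4)] product_arr_arr[OF arrs(1)] product_arr_arr[OF arrs(2)]
    product_arr_arr[OF arrs(3)] product_arr_arr[OF arrs(4)]
  note e [simp] = comp_reassoc[OF product_arr_arr(4)[OF arrs(1)]] comp_reassoc[OF product_arr_arr(5)[OF arrs(1)]]
    comp_reassoc[OF product_arr_arr(4)[OF arrs(2)]] comp_reassoc[OF product_arr_arr(5)[OF arrs(2)]]
    comp_reassoc[OF product_arr_arr(4)[OF arrs(3)]] comp_reassoc[OF product_arr_arr(5)[OF arrs(3)]]
    comp_reassoc[OF product_arr_arr(4)[OF arrs(4)]] comp_reassoc[OF product_arr_arr(5)[OF arrs(4)]]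
  note fa [simp] = comp_reassoc[OF pullback_arr(9)[OF P]]
  have 1: "ff \<cdot> aa = gg \<cdot> bb"
    by (rule product_eq[OF prods(2)]) simp_all
  have 2: "\<exists>z \<in> Hom C (Dom C x) (Dom C aa). aa \<cdot> z = x \<and> bb \<cdot> z = y"
    if xy: "x \<in> Arr C" "y \<in> Arr C" "Dom C y = Dom C x" "Cod C x = Dom C ff" "Cod C y = Dom C gg"
      "ff \<cdot> x = gg \<cdot> y" for x y
  proof -
    have "f \<cdot> (f\<^sub>1 \<cdot> x) = c\<^sub>1 \<cdot> (ff \<cdot> x)" using xy(1-5) by simp
    also have "\<dots> = g \<cdot> (g\<^sub>1 \<cdot> y)"
      unfolding xy(6) using xy(1-5) by simp
    finally have 11: "f \<cdot> (f\<^sub>1 \<cdot> x) = g \<cdot> (g\<^sub>1 \<cdot> y)" .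
    have "f \<cdot> (f\<^sub>2 \<cdot> x) = c\<^sub>2 \<cdot> (ff \<cdot> x)" using xy(1-5) by simp
    also have "\<dots> = g \<cdot> (g\<^sub>2 \<cdot> y)"
      unfolding xy(6) using xy(1-5) by simp
    finally have 22: "f \<cdot> (f\<^sub>2 \<cdot> x) = g \<cdot> (g\<^sub>2 \<cdot> y)" .
    obtain u where u: "u \<in> Arr C" "Dom C u = Dom C (f\<^sub>1 \<cdot> x)" "Cod C u = Dom C a" "a \<cdot> u = f\<^sub>1 \<cdot> x" "b \<cdot> u = g\<^sub>1 \<cdot> y"
      by (rule pullback_lift[OF P _ _ _ _ _ 11]) (use xy in auto)
    obtain v where v: "v \<in> Arr C" "Dom C v = Dom C (f\<^sub>2 \<cdot> x)" "Cod C v = Dom C a" "a \<cdot> v = f\<^sub>2 \<cdot> x" "b \<cdot> v = g\<^sub>2 \<cdot> y"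
      by (rule pullback_lift[OF P _ _ _ _ _ 22]) (use xy in auto)
    obtain z where z: "z \<in> Arr C" "Dom C z = Dom C u" "Cod C z = Dom C a\<^sub>1" "a\<^sub>1 \<cdot> z = u" "a\<^sub>2 \<cdot> z = v"
      by (rule product_lift[OF prods(4), of u v]) (use xy u v in auto)
    have "aa \<cdot> z = x" by (rule product_eq[OF prods(1)]) (use xy u v z in simp_all)
    moreover have "bb \<cdot> z = y" by (rule product_eq[OF prods(3)]) (use xy u v z in simp_all)
    ultimately show ?thesis using z u xy by auto
  qed
  have 3: "z = z'" if z: "z \<in> Arr C" "z' \<in> Arr C" "Dom C z' = Dom C z" "Cod C z = Dom C aa"
      "Cod C z' = Dom C aa" "aa \<cdot> z = aa \<cdot> z'" "bb \<cdot> z = bb \<cdot> z'" for z z'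
  proof -
    have a: "f\<^sub>1 \<cdot> (aa \<cdot> z) = f\<^sub>1 \<cdot> (aa \<cdot> z')" "f\<^sub>2 \<cdot> (aa \<cdot> z) = f\<^sub>2 \<cdot> (aa \<cdot> z')" using z by auto
    have b: "g\<^sub>1 \<cdot> (bb \<cdot> z) = g\<^sub>1 \<cdot> (bb \<cdot> z')" "g\<^sub>2 \<cdot> (bb \<cdot> z) = g\<^sub>2 \<cdot> (bb \<cdot> z')" using z by auto
    have "a\<^sub>1 \<cdot> z = a\<^sub>1 \<cdot> z'"
      by (rule pullback_eq[OF P]) (use z(1-5) a b in simp_all)
    moreover have "a\<^sub>2 \<cdot> z = a\<^sub>2 \<cdot> z'"
      by (rule pullback_eq[OF P]) (use z(1-5) a b in simp_all)
    ultimately show ?thesis using product_eq[OF prods(4)] z by auto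
  qed
  show ?thesis by (rule is_pullbackI) (use 1 2 3 in simp_all)
qed

text \<open>Mutually included monos differ by an isomorphism, and precomposing a pullback cone with
  an isomorphism keeps it a pullback.\<close>

lemma char_iso:
  assumes "is_char C t m \<chi>" "mono_arr C m" "mono_arr C m'" "sub_le C m m'" "sub_le C m' m"
  shows "is_char C t m' \<chi>"
proof -
  obtain q where P: "is_pullback C \<chi> t m q" using assms(1) is_char_def by metis
  note a = pullback_arr[OF P]
  obtain h where h: "h \<in> Arr C" "Dom C h = Dom C m'" "Cod C h = Dom C m" "m \<cdot> h = m'"
    using assms(5) by (auto simp: sub_le_def)
  obtain h' where h': "h' \<in> Arr C" "Dom C h' = Dom C m" "Cod C h' = Dom C m'" "m' \<cdot> h' = m"
    using assms(4) by (auto simp: sub_le_def)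
  have m': "m' \<in> Arr C" using assms(3) by (simp add: mono_arr_def)
  have e2: "h' \<cdot> h = Id C (Dom C m')"
    by (rule mono_cancel[OF assms(3)]) (simp_all add: h h' m' comp_reassoc1[OF h'(4)])
  have e1: "h \<cdot> h' = Id C (Dom C m)"
    by (rule mono_cancel[OF assms(2)]) (simp_all add: a h h' m' comp_reassoc1[OF h(4)])
  have "is_pullback C \<chi> t (m \<cdot> h) (q \<cdot> h)"
    by (rule pullback_iso[OF P h(1) h'(1)]) (simp_all add: h h' e1 e2)
  then show ?thesis unfolding is_char_def h(4) by blast
qed

text \<open>For \<open>f = true\<close> this says that \<open>char true\<close> is the
  identity.\<close>

lemma pullback_id: "f \<in> Arr C \<Longrightarrow> is_pullback C (Id C (Cod C f)) f f (Id C (Dom C f))"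
  by (rule is_pullbackI) auto

text \<open>Continuity speaks of closures of images; for the monos \<open>true\<close> and
  \<open>G(true)\<close> the image step is thereby trivial.\<close>

lemma mono_is_image: "mono_arr C f \<Longrightarrow> is_image C f f"
  unfolding is_image_def
proof (intro conjI allI impI)
  assume "mono_arr C f"
  then have "f \<in> Arr C" by (simp add: mono_arr_def)
  then show "sub_le C f f" unfolding sub_le_def by (intro conjI bexI[of _ "Id C (Dom C f)"]) simp_all
qed simp_all

text \<open>The converse half of the pasting lemma: the lift through the outer rectangle of
  \<open>x\<close> and \<open>q \<cdot> y\<close> also solves the inner square, because
  \<open>p\<close> and \<open>q\<close> are jointly monic.\<close>

lemma pullback_cancel:
  assumes "is_pullback C f g p q" "is_pullback C (f \<cdot> h) g r z"
    and "h \<in> Arr C" "Cod C h = Dom C f" "s \<in> Arr C" "Dom C s = Dom C r" "Cod C s = Dom C p"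
    and "p \<cdot> s = h \<cdot> r" "q \<cdot> s = z"
  shows "is_pullback C h p r s"
proof -
  note P = assms(1) and R = assms(2)
  note [simp] = assms(3-7) pullback_arr(1-8)[OF P]
  have [simp]: "r \<in> Arr C" "Cod C r = Dom C h"
    using pullback_arr(3,6)[OF R] by simp_all
  show ?thesis
  proof (rule is_pullbackI)
    fix x y assume [simp]: "x \<in> Arr C" "y \<in> Arr C" "Dom C y = Dom C x" "Cod C x = Dom C h" "Cod C y = Dom C p"
      and xy: "h \<cdot> x = p \<cdot> y"
    have e: "(f \<cdot> h) \<cdot> x = g \<cdot> (q \<cdot> y)"
      using comp_reassoc[OF pullback_arr(9)[OF P], of y] xy by simp
    obtain u where u [simp]: "u \<in> Arr C" "Dom C u = Dom C x" "Cod C u = Dom C r" and ru: "r \<cdot> u = x" and zu: "z \<cdot> u = q \<cdot> y"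
      by (rule pullback_lift[OF R _ _ _ _ _ e]) simp_all
    have "s \<cdot> u = y"
    proof (rule pullback_eq[OF P])
      show "p \<cdot> (s \<cdot> u) = p \<cdot> y"
        unfolding xy[symmetric] ru[symmetric] by (rule comp_reassoc[OF assms(8)]) simp_all
      show "q \<cdot> (s \<cdot> u) = q \<cdot> y"
        unfolding zu[symmetric] by (rule comp_reassoc1[OF assms(9)]) simp_all
    qed simp_all
    then show "\<exists>u \<in> Hom C (Dom C x) (Dom C r). r \<cdot> u = x \<and> s \<cdot> u = y"
      using ru by (intro bexI[of _ u]) simp_all
  next
    fix u u' assume u: "u \<in> Arr C" "u' \<in> Arr C" "Dom C u' = Dom C u" "Cod C u = Dom C r"
      "Cod C u' = Dom C r" "r \<cdot> u = r \<cdot> u'" "s \<cdot> u = s \<cdot> u'"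
    have "z \<cdot> u = q \<cdot> (s \<cdot> u)"
      by (rule comp_reassoc1[OF assms(9), symmetric]) (use u(1-5) in simp_all)
    also have "\<dots> = z \<cdot> u'"
      unfolding u(7) by (rule comp_reassoc1[OF assms(9)]) (use u(1-5) in simp_all)
    finally have "z \<cdot> u = z \<cdot> u'" .
    then show "u = u'" by - (rule pullback_eq[OF R, of u u'], use u in simp_all)
  qed (simp_all add: assms(8))
qed

text \<open>This makes \<open>true \<times> true\<close> a mono, so that it has a characteristic
  arrow.\<close>

lemma product_arr_mono:
  assumes P: "is_product C A B p q" and R: "is_product C A' B' r s" and h: "is_product_arr C r s p q f g h"
    and f: "mono_arr C f" "Dom C f = A'" and g: "mono_arr C g" "Dom C g = B'"
  shows "mono_arr C h"
proof (rule mono_arrI)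
  have [simp]: "f \<in> Arr C" "g \<in> Arr C" using f g by (simp_all add: mono_arr_def)
  note [simp] = product_arr[OF P] product_arr[OF R] product_arr_arr(1-3)[OF h] f(2) g(2)
  show "h \<in> Arr C" by simp
  fix u v assume [simp]: "u \<in> Arr C" "v \<in> Arr C" "Dom C u = Dom C v" "Cod C u = Dom C h" "Cod C v = Dom C h"
    and e: "h \<cdot> u = h \<cdot> v"
  have "f \<cdot> (r \<cdot> u) = p \<cdot> (h \<cdot> u)" by (rule comp_reassoc[OF product_arr_arr(4)[OF h, symmetric]]) simp_all
  also have "\<dots> = f \<cdot> (r \<cdot> v)" unfolding e by (rule comp_reassoc[OF product_arr_arr(4)[OF h]]) simp_all
  finally have 1: "r \<cdot> u = r \<cdot> v" by (rule mono_cancel[OF f(1)]) simp_all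
  have "g \<cdot> (s \<cdot> u) = q \<cdot> (h \<cdot> u)" by (rule comp_reassoc[OF product_arr_arr(5)[OF h, symmetric]]) simp_all
  also have "\<dots> = g \<cdot> (s \<cdot> v)" unfolding e by (rule comp_reassoc[OF product_arr_arr(5)[OF h]]) simp_all
  finally have 2: "s \<cdot> u = s \<cdot> v" by (rule mono_cancel[OF g(1)]) simp_all
  show "u = v" by (rule product_eq[OF R]) (use 1 2 in simp_all)
qed

lemma equalizer_lift:
  assumes "is_equalizer C f g m" "x \<in> Arr C" "Cod C x = Dom C f" "f \<cdot> x = g \<cdot> x"
  shows "\<exists>!h. h \<in> Hom C (Dom C x) (Dom C m) \<and> m \<cdot> h = x"
proof -
  have "x \<in> Hom C (Dom C x) (Dom C f)" using assms by simp
  moreover have "\<forall>X. \<forall>x \<in> Hom C X (Dom C f). f \<cdot> x = g \<cdot> x \<longrightarrow>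
      (\<exists>!h. h \<in> Hom C X (Dom C m) \<and> m \<cdot> h = x)"
    using assms(1) unfolding is_equalizer_def by (elim conjE)
  ultimately show ?thesis using assms(4) by blast
qed

text \<open>The classifier gives uniqueness for monos; \<open>n\<close> is one, being a pullback of
  \<open>true\<close>, which is monic because its domain is terminal.\<close>

lemma char_unique:
  assumes t: "subobject_classifier C t" and "is_char C t n \<chi>" "is_char C t n \<chi>'"
  shows "\<chi> = \<chi>'"
proof -
  have "mono_arr C t" using t terminal_mono[of t] by (simp add: subobject_classifier_def)
  then have "mono_arr C n" using assms(2) pullback_mono unfolding is_char_def by blast
  then show ?thesis using assms unfolding subobject_classifier_def by blast
qed

end

section \<open>Finite limits and their preservation\<close>

text \<open>Arrows \<open>0, 1, 2\<close> are the identities, \<open>3 : 0 \<rightarrow> 2\<close> and \<open>4 : 1 \<rightarrow> 2\<close> the two legs.\<close>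

definition cospan_shape :: "(nat, nat) precategory" where
  "cospan_shape = \<lparr>Obj = {0, 1, 2}, Arr = {0, 1, 2, 3, 4},
     Dom = (\<lambda>u. if u = 3 then 0 else if u = 4 then 1 else u), Cod = (\<lambda>u. if u < 3 then u else 2),
     Id = (\<lambda>i. i), Comp = (\<lambda>g f. if g < 3 then f else g)\<rparr>"

definition cospan_diagram :: "('o, 'a) precategory \<Rightarrow> 'a \<Rightarrow> 'a \<Rightarrow> (nat, nat, 'o, 'a) functor_data" where
  "cospan_diagram C f g = \<lparr>
     ObjMap = (\<lambda>i. if i = 0 then Dom C f else if i = 1 then Dom C g else Cod C f),
     ArrMap = (\<lambda>u. if u = 0 then Id C (Dom C f) else if u = 1 then Id C (Dom C g)
       else if u = 2 then Id C (Cod C f) else if u = 3 then f else g)\<rparr>"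

definition empty_shape :: "(nat, nat) precategory" where
  "empty_shape = \<lparr>Obj = {}, Arr = {}, Dom = id, Cod = id, Id = id, Comp = (\<lambda>g f. f)\<rparr>"

lemma finite_shapes: "finite_shape cospan_shape" "finite_shape empty_shape"
  unfolding finite_shape_def category_def cospan_shape_def empty_shape_def by auto

context category
begin

lemma cospan_functor:
  assumes "f \<in> Arr C" "g \<in> Arr C" "Cod C g = Cod C f"
  shows "cat_functor cospan_shape C (cospan_diagram C f g)"
proof -
  note [simp] = assms
  show ?thesis
  proof (intro cat_functor.intro cat_functor_axioms.intro category_axioms)
    show "category cospan_shape" using finite_shapes by (simp add: finite_shape_def)
  qed (auto simp: cospan_shape_def cospan_diagram_def split: if_splits)
qed

text \<open>The leg at the vertex \<open>2\<close> is forced by the one at \<open>0\<close>, so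
  cones are exactly commuting squares.\<close>

lemma cospan_cone:
  assumes "f \<in> Arr C" "g \<in> Arr C" "Cod C g = Cod C f"
  shows "is_cone cospan_shape C (cospan_diagram C f g) X l \<longleftrightarrow> X \<in> Obj C \<and>
    l 0 \<in> Hom C X (Dom C f) \<and> l 1 \<in> Hom C X (Dom C g) \<and> l 2 = f \<cdot> l 0 \<and> f \<cdot> l 0 = g \<cdot> l 1"
  using assms unfolding is_cone_def cospan_shape_def cospan_diagram_def by auto

lemma limit_cospan_pullback:
  assumes fg: "f \<in> Arr C" "g \<in> Arr C" "Cod C g = Cod C f"
    and L: "is_limit cospan_shape C (cospan_diagram C f g) X l"
  shows "is_pullback C f g (l 0) (l 1)"
proof -
  note c = cospan_cone[OF fg]
  have l: "l 0 \<in> Hom C X (Dom C f)" "l 1 \<in> Hom C X (Dom C g)" "l 2 = f \<cdot> l 0" "f \<cdot> l 0 = g \<cdot> l 1"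
    using L unfolding is_limit_def c by blast+
  have U: "\<exists>!h. h \<in> Hom C Y X \<and> l 0 \<cdot> h = x \<and> l 1 \<cdot> h = y"
    if xy: "x \<in> Hom C Y (Dom C f)" "y \<in> Hom C Y (Dom C g)" "f \<cdot> x = g \<cdot> y" for Y x y
  proof -
    let ?l = "\<lambda>i::nat. if i = 0 then x else if i = 1 then y else f \<cdot> x"
    have "is_cone cospan_shape C (cospan_diagram C f g) Y ?l"
      unfolding c using xy by auto
    then have E: "\<exists>!h. h \<in> Hom C Y X \<and> (\<forall>i \<in> Obj cospan_shape. l i \<cdot> h = ?l i)"
      using L unfolding is_limit_def by blast
    have "(\<forall>i \<in> Obj cospan_shape. l i \<cdot> h = ?l i) \<longleftrightarrow> l 0 \<cdot> h = x \<and> l 1 \<cdot> h = y"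
      if "h \<in> Hom C Y X" for h
    proof -
      have "(f \<cdot> l 0) \<cdot> h = f \<cdot> (l 0 \<cdot> h)" using that l(1) fg(1) by simp
      then show ?thesis using l(3) by (auto simp: cospan_shape_def)
    qed
    then show ?thesis using E by (metis (no_types, lifting))
  qed
  have X: "Dom C (l 0) = X" using l by simp
  show ?thesis unfolding is_pullback_def X
  proof (intro conjI allI ballI impI)
    fix Y x y assume "x \<in> Hom C Y (Dom C f)" "y \<in> Hom C Y (Dom C g)" "f \<cdot> x = g \<cdot> y"
    then show "\<exists>!h. h \<in> Hom C Y X \<and> l 0 \<cdot> h = x \<and> l 1 \<cdot> h = y" by (rule U)
  qed (use fg l in simp_all)
qed

lemma pullback_limit_cospan:
  assumes P: "is_pullback C f g p q"
  shows "is_limit cospan_shape C (cospan_diagram C f g) (Dom C p)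
    (\<lambda>i. if i = 0 then p else if i = 1 then q else f \<cdot> p)" (is "is_limit _ _ _ _ ?l")
proof -
  note a = pullback_arr[OF P]
  note c = cospan_cone[OF a(1,2,5)]
  have "\<exists>!h. h \<in> Hom C Y (Dom C p) \<and> (\<forall>i \<in> Obj cospan_shape. ?l i \<cdot> h = l' i)"
    if "is_cone cospan_shape C (cospan_diagram C f g) Y l'" for Y l'
  proof -
    have l': "l' 0 \<in> Hom C Y (Dom C f)" "l' 1 \<in> Hom C Y (Dom C g)" "l' 2 = f \<cdot> l' 0" "f \<cdot> l' 0 = g \<cdot> l' 1"
      using that unfolding c by blast+
    have E: "\<exists>!h. h \<in> Hom C Y (Dom C p) \<and> p \<cdot> h = l' 0 \<and> q \<cdot> h = l' 1"
      using P l' unfolding is_pullback_def by blast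
    have "(\<forall>i \<in> Obj cospan_shape. ?l i \<cdot> h = l' i) \<longleftrightarrow> p \<cdot> h = l' 0 \<and> q \<cdot> h = l' 1"
      if "h \<in> Hom C Y (Dom C p)" for h
    proof -
      have "(f \<cdot> p) \<cdot> h = f \<cdot> (p \<cdot> h)" using that a(1,3,6) by simp
      then show ?thesis using l'(3) by (auto simp: cospan_shape_def)
    qed
    then show ?thesis using E by (metis (no_types, lifting))
  qed
  moreover have "is_cone cospan_shape C (cospan_diagram C f g) (Dom C p) ?l"
    unfolding c using a by simp
  ultimately show ?thesis unfolding is_limit_def by blast
qed

lemma pullback_ex:
  assumes "has_finite_limits C" "f \<in> Arr C" "g \<in> Arr C" "Cod C g = Cod C f"
  obtains p q where "is_pullback C f g p q"
  using assms(1) cospan_functor[OF assms(2-4)] limit_cospan_pullback[OF assms(2-4)] finite_shapes(1) that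
  unfolding has_finite_limits_def by blast

lemma limit_empty_iff_terminal: "is_limit empty_shape C D X l \<longleftrightarrow> terminal_obj C X"
  unfolding is_limit_def is_cone_def terminal_obj_def empty_shape_def by auto

end

context cat_functor
begin

lemma functor_arr [simp]:
  assumes "f \<in> Arr C"
  shows "ArrMap F f \<in> Arr D" "Dom D (ArrMap F f) = ObjMap F (Dom C f)"
    "Cod D (ArrMap F f) = ObjMap F (Cod C f)"
  using ArrMap_in_Hom[of f "Dom C f" "Cod C f"] assms by auto

lemma functor_id_comp [simp]:
  "A \<in> Obj C \<Longrightarrow> ArrMap F (Id C A) = Id D (ObjMap F A)"
  "\<lbrakk>f \<in> Arr C; g \<in> Arr C; Dom C g = Cod C f\<rbrakk>
    \<Longrightarrow> ArrMap F (g \<cdot>\<^bsub>C\<^esub> f) = ArrMap F g \<cdot>\<^bsub>D\<^esub> ArrMap F f"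
  using ArrMap_Comp[of f "Dom C f" "Cod C f" g "Cod C g"] by (simp_all add: ArrMap_Id)

declare ObjMap_in_Obj [simp]

lemma preserves_pullback:
  assumes F: "preserves_finite_limits C D F" and P: "is_pullback C f g p q"
  shows "is_pullback D (ArrMap F f) (ArrMap F g) (ArrMap F p) (ArrMap F q)"
proof -
  note a [simp] = source.pullback_arr(1-8)[OF P]
  let ?l = "\<lambda>i::nat. if i = 0 then p else if i = 1 then q else f \<cdot>\<^bsub>C\<^esub> p"
  \<comment> \<open>The records agree as total functions, not just on the shape: the default
    branches of \<open>cospan_diagram\<close> are \<open>Cod C f\<close> and \<open>g\<close>, which
    \<open>F\<close> carries to the default branches of the image diagram.\<close>
  have d: "functor_comp F (cospan_diagram C f g) = cospan_diagram D (ArrMap F f) (ArrMap F g)"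
    unfolding functor_comp_def cospan_diagram_def by (auto simp: fun_eq_iff)
  have L: "is_limit cospan_shape D (functor_comp F (cospan_diagram C f g)) (ObjMap F (Dom C p)) (ArrMap F \<circ> ?l)"
    using F source.pullback_limit_cospan[OF P] source.cospan_functor[of f g] finite_shapes(1)
    unfolding preserves_finite_limits_def by simp
  have "is_pullback D (ArrMap F f) (ArrMap F g) ((ArrMap F \<circ> ?l) 0) ((ArrMap F \<circ> ?l) 1)"
    by (rule target.limit_cospan_pullback[OF _ _ _ L[unfolded d]]) simp_all
  then show ?thesis by simp
qed

lemma preserves_terminal:
  assumes F: "preserves_finite_limits C D F" and T: "terminal_obj C T"
  shows "terminal_obj D (ObjMap F T)"
proof -
  have "cat_functor empty_shape C \<lparr>ObjMap = \<lambda>_. T, ArrMap = \<lambda>_. Id C T\<rparr>" (is "cat_functor _ _ ?K")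
  proof (intro cat_functor.intro cat_functor_axioms.intro source.category_axioms)
    show "category empty_shape" using finite_shapes by (simp add: finite_shape_def)
  qed (simp_all add: empty_shape_def)
  moreover have "is_limit empty_shape C ?K T (\<lambda>_. Id C T)"
    using T by (simp add: source.limit_empty_iff_terminal)
  ultimately have "is_limit empty_shape D (functor_comp F ?K) (ObjMap F T) (ArrMap F \<circ> (\<lambda>_. Id C T))"
    using F finite_shapes(2) unfolding preserves_finite_limits_def by blast
  then show ?thesis by (simp add: target.limit_empty_iff_terminal)
qed

text \<open>An arrow is monic exactly when its kernel pair consists of identities, and this is a
  pullback condition.\<close>

lemma preserves_mono:
  assumes F: "preserves_finite_limits C D F" and m: "mono_arr C m"
  shows "mono_arr D (ArrMap F m)"
proof -
  have [simp]: "m \<in> Arr C" using m by (simp add: mono_arr_def)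
  have "is_pullback C m m (Id C (Dom C m)) (Id C (Dom C m))"
  proof (rule source.is_pullbackI)
    fix x y assume "x \<in> Arr C" "y \<in> Arr C" "Dom C y = Dom C x" "Cod C x = Dom C m" "Cod C y = Dom C m"
      "m \<cdot>\<^bsub>C\<^esub> x = m \<cdot>\<^bsub>C\<^esub> y"
    then show "\<exists>h\<in>Hom C (Dom C x) (Dom C (Id C (Dom C m))). Id C (Dom C m) \<cdot>\<^bsub>C\<^esub> h = x \<and> Id C (Dom C m) \<cdot>\<^bsub>C\<^esub> h = y"
      using source.mono_cancel[OF m, of x y] by (intro bexI[of _ x]) simp_all
  qed simp_all
  then have P: "is_pullback D (ArrMap F m) (ArrMap F m) (Id D (ObjMap F (Dom C m))) (Id D (ObjMap F (Dom C m)))"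
    using preserves_pullback[OF F, of m m "Id C (Dom C m)" "Id C (Dom C m)"] by simp
  show ?thesis
  proof (rule target.mono_arrI)
    fix f g assume fg: "f \<in> Arr D" "g \<in> Arr D" "Dom D f = Dom D g" "Cod D f = Dom D (ArrMap F m)"
      "Cod D g = Dom D (ArrMap F m)" "ArrMap F m \<cdot>\<^bsub>D\<^esub> f = ArrMap F m \<cdot>\<^bsub>D\<^esub> g"
    obtain h where h: "h \<in> Arr D" "Cod D h = ObjMap F (Dom C m)"
      "Id D (ObjMap F (Dom C m)) \<cdot>\<^bsub>D\<^esub> h = f" "Id D (ObjMap F (Dom C m)) \<cdot>\<^bsub>D\<^esub> h = g"
      by (rule target.pullback_lift[OF P fg(1-3) _ _ fg(6)]) (use fg(4,5) in simp_all)
    show "f = g" using h(3,4) by simp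
  qed simp
qed

end

section \<open>Double factorization systems\<close>

context double_factorization_system
begin

lemma EJM_arr [simp]: "e \<in> \<E> \<Longrightarrow> e \<in> Arr C" "j \<in> \<J> \<Longrightarrow> j \<in> Arr C" "m \<in> \<M> \<Longrightarrow> m \<in> Arr C"
  using E_arr J_arr M_arr by auto

lemma factorize:
  assumes "f \<in> Arr C"
  obtains e j m where "e \<in> \<E>" "j \<in> \<J>" "m \<in> \<M>" "Dom C j = Cod C e" "Dom C m = Cod C j"
    "f = m \<cdot> (j \<cdot> e)"
proof -
  have "f \<in> class_comp C \<M> (class_comp C \<J> \<E>)" using assms factorization by auto
  then obtain m a where m: "m \<in> \<M>" "a \<in> class_comp C \<J> \<E>" "Dom C m = Cod C a" "f = m \<cdot> a"
    unfolding class_comp_def by blast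
  then obtain e j where "e \<in> \<E>" "j \<in> \<J>" "Dom C j = Cod C e" "a = j \<cdot> e"
    unfolding class_comp_def by blast
  then show thesis using m that by simp
qed

lemma diagonal_fill:
  assumes "e \<in> \<E>" "j \<in> \<J>" "j' \<in> \<J>" "m \<in> \<M>" "u \<in> Arr C" "v \<in> Arr C"
    "Dom C j = Cod C e" "Dom C m = Cod C j'" "Dom C u = Dom C e" "Cod C u = Dom C j'"
    "Dom C v = Cod C j" "Cod C v = Cod C m" "v \<cdot> (j \<cdot> e) = m \<cdot> (j' \<cdot> u)"
  obtains s t where "s \<in> Arr C" "t \<in> Arr C" "Dom C s = Cod C e" "Cod C s = Dom C j'"
    "Dom C t = Cod C j" "Cod C t = Dom C m" "s \<cdot> e = u" "j' \<cdot> s = t \<cdot> j" "m \<cdot> t = v"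
proof -
  have "\<exists>!(s, t). s \<in> Hom C (Cod C e) (Dom C j') \<and> t \<in> Hom C (Cod C j) (Cod C j') \<and>
      s \<cdot> e = u \<and> j' \<cdot> s = t \<cdot> j \<and> m \<cdot> t = v"
    by (rule diagonal[of e "Dom C e" _ j _ j' _ _ m "Cod C m"]) (use assms in simp_all)
  then show thesis using that assms(8) by (auto elim!: ex1E)
qed

text \<open>Both pairs fill the square with top \<open>s \<cdot> e\<close> and bottom
  \<open>m \<cdot> t\<close>. This is the means of proving equations between arrows on intermediate
  objects of factorizations.\<close>

lemma diagonal_unique:
  assumes "e \<in> \<E>" "j \<in> \<J>" "j' \<in> \<J>" "m \<in> \<M>"
    "Dom C j = Cod C e" "Dom C m = Cod C j'"
    "s \<in> Hom C (Cod C e) (Dom C j')" "t \<in> Hom C (Cod C j) (Cod C j')"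
    "s' \<in> Hom C (Cod C e) (Dom C j')" "t' \<in> Hom C (Cod C j) (Cod C j')"
    "s \<cdot> e = s' \<cdot> e" "j' \<cdot> s = t \<cdot> j" "j' \<cdot> s' = t' \<cdot> j" "m \<cdot> t = m \<cdot> t'"
  shows "s = s'" "t = t'"
proof -
  have a: "e \<in> Arr C" "j \<in> Arr C" "j' \<in> Arr C" "m \<in> Arr C" "s \<in> Arr C" "t \<in> Arr C"
     "Dom C s = Cod C e" "Cod C s = Dom C j'" "Dom C t = Cod C j" "Cod C t = Cod C j'"
    using assms by simp_all
  have "(m \<cdot> t) \<cdot> (j \<cdot> e) = m \<cdot> (j' \<cdot> (s \<cdot> e))"
    using a assms(5,6) comp_reassoc[OF assms(12), of e] by simp
  then have ex: "\<exists>!(x, y). x \<in> Hom C (Cod C e) (Dom C j') \<and> y \<in> Hom C (Cod C j) (Cod C j') \<and>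
      x \<cdot> e = s \<cdot> e \<and> j' \<cdot> x = y \<cdot> j \<and> m \<cdot> y = m \<cdot> t" (is "Ex1 ?P")
    by - (rule diagonal[of e "Dom C e" _ j _ j' _ _ m "Cod C m"], use a assms in simp_all)
  have "?P (s, t)" "?P (s', t')"
    unfolding prod.case using assms(7-14) by (blast, metis)
  then have "(s, t) = (s', t')"
    using ex by blast
  then show "s = s'" "t = t'" by simp_all
qed

text \<open>In any factorization of an identity the outer factors turn out invertible, which
  exhibits the identity as a member of Iso \<J> Iso.\<close>

lemma id_in_J:
  assumes "A \<in> Obj C"
  shows "Id C A \<in> \<J>"
proof -
  obtain e j m where f: "e \<in> \<E>" "j \<in> \<J>" "m \<in> \<M>" "Dom C j = Cod C e" "Dom C m = Cod C j"
    "Id C A = m \<cdot> (j \<cdot> e)"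
    using factorize[of "Id C A"] assms by auto
  have [simp]: "e \<in> Arr C" "j \<in> Arr C" "m \<in> Arr C" "Dom C j = Cod C e" "Dom C m = Cod C j"
    using f by simp_all
  have "Dom C (Id C A) = Dom C (m \<cdot> (j \<cdot> e))" "Cod C (Id C A) = Cod C (m \<cdot> (j \<cdot> e))" using f(6) by simp_all
  then have A [simp]: "Dom C e = A" "Cod C m = A" using assms by simp_all
  note [simp] = assms
  note r = comp_reassoc1[OF f(6)[symmetric]]
  have mj: "m \<cdot> (j \<cdot> (e \<cdot> x)) = x" if "x \<in> Arr C" "Cod C x = A" for x
    using comp_assoc[of x "j \<cdot> e" m] comp_assoc[of x e j] f(6)[symmetric] that by simp
  \<comment> \<open>Both \<open>(1, 1)\<close> and \<open>(e m j, j e m)\<close> are diagonals of the square of \<open>m j e\<close> with itself.\<close>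
  have e: "e \<cdot> (m \<cdot> j) = Id C (Cod C e)"
    by (rule diagonal_unique(1)[OF f(1,2,2,3), where t = "j \<cdot> (e \<cdot> m)" and t' = "Id C (Cod C j)"])
      (simp_all add: f(6)[symmetric] mj)
  have j: "j \<cdot> (e \<cdot> m) = Id C (Cod C j)"
    by (rule diagonal_unique(2)[OF f(1,2,2,3), where s = "e \<cdot> (m \<cdot> j)" and s' = "Id C (Cod C e)"])
      (simp_all add: f(6)[symmetric] mj)
  have "iso_arr C e"
    unfolding iso_arr_def by (intro conjI bexI[of _ "m \<cdot> j"]) (simp_all add: e f(6)[symmetric])
  moreover have "iso_arr C m"
    unfolding iso_arr_def by (intro conjI bexI[of _ "j \<cdot> e"]) (simp_all add: j f(6)[symmetric])
  ultimately have "m \<cdot> (j \<cdot> e) \<in> class_comp C (Collect (iso_arr C)) (class_comp C \<J> (Collect (iso_arr C)))"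
    unfolding class_comp_def using f(2) by fastforce
  then show ?thesis using Iso_J_Iso f(6) by auto
qed

end

context cartesian_dfs
begin

text \<open>Writing \<open>m\<close> as \<open>m\<close> after an identity places it in the class of
  composites assumed monic, since identities lie in \<J>.\<close>

lemma M_mono:
  assumes "m \<in> \<M>"
  shows "mono_arr C m"
proof -
  have "m \<in> Arr C" using assms by simp
  moreover from this have "m \<cdot> Id C (Dom C m) \<in> class_comp C \<M> \<J>"
    unfolding class_comp_def using assms id_in_J[of "Dom C m"] by fastforce
  ultimately show ?thesis using MJ_mono by auto
qed

text \<open>The filler \<open>t\<close> of the diagonal is the comparison map. Arbitrary arrows
  \<open>m\<close> and \<open>u\<close> are allowed so that \<open>m\<close> may be a pulled back
  mono or a composite \<open>\<chi> \<cdot> m\<close>, and \<open>u\<close> may be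
  \<open>ArrMap G e0\<close>.\<close>

lemma factorization_sub_le:
  assumes "e \<in> \<E>" "j \<in> \<J>" "m \<in> Arr C" "Dom C j = Cod C e" "Dom C m = Cod C j"
    and "j' \<in> \<J>" "m' \<in> \<M>" "u \<in> Arr C" "Dom C u = Dom C e" "Cod C u = Dom C j'" "Dom C m' = Cod C j'"
    and "m \<cdot> (j \<cdot> e) = m' \<cdot> (j' \<cdot> u)" "Cod C m = Cod C m'"
  shows "sub_le C m m'"
proof -
  obtain s t where "t \<in> Arr C" "Dom C t = Cod C j" "Cod C t = Dom C m'" "m' \<cdot> t = m"
    by (rule diagonal_fill[OF assms(1,2,6,7,8,3)]) (use assms in simp_all)
  then show ?thesis using assms(3,5,7) unfolding sub_le_def by (intro conjI bexI[of _ t]) simp_all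
qed

text \<open>Pulling back \<open>k\<close> along \<open>\<chi>\<close> shows that the closure of a subobject is the \<open>\<M>\<close>-part of its
  factorization.\<close>

lemma char_M_part:
  assumes lim: "has_finite_limits C" and t: "mono_arr C t"
    and gen: "generates_topology C t \<E> \<J> \<M> k"
    and f: "e \<in> \<E>" "j \<in> \<J>" "m \<in> \<M>" "Dom C j = Cod C e" "Dom C m = Cod C j"
    and ch: "is_char C t (m \<cdot> (j \<cdot> e)) \<chi>"
  shows "is_char C t m (k \<cdot> \<chi>)"
proof -
  obtain q where P: "is_pullback C \<chi> t (m \<cdot> (j \<cdot> e)) q"
    using ch unfolding is_char_def by blast
  obtain e0 j0 m0 where g: "e0 \<in> \<E>" "j0 \<in> \<J>" "m0 \<in> \<M>" "Dom C j0 = Cod C e0" "Dom C m0 = Cod C j0"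
      "t = m0 \<cdot> (j0 \<cdot> e0)" "is_char C t m0 k" and k: "k \<in> Hom C (Cod C t) (Cod C t)"
    using gen unfolding generates_topology_def lawvere_tierney_def by blast
  obtain q0 where K: "is_pullback C k t m0 q0"
    using g(7) unfolding is_char_def by blast
  have [simp]: "e \<in> Arr C" "j \<in> Arr C" "m \<in> Arr C" "e0 \<in> Arr C" "j0 \<in> Arr C" "m0 \<in> Arr C"
    using f g by simp_all
  note [simp] = f(4,5) g(4,5)
  have [simp]: "Cod C t = Cod C m0" "Dom C t = Dom C e0" unfolding g(6) by simp_all
  note [simp] = pullback_arr(1-4)[OF P]
  have [simp]: "Dom C \<chi> = Cod C m" "Cod C \<chi> = Cod C m0" "Cod C q = Dom C e0" "Dom C q = Dom C e"
    using pullback_arr(5-8)[OF P] by simp_all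
  have sq: "\<chi> \<cdot> (m \<cdot> (j \<cdot> e)) = m0 \<cdot> (j0 \<cdot> (e0 \<cdot> q))"
    using pullback_arr(9)[OF P] unfolding g(6) by simp
  obtain m1 x where M1: "is_pullback C \<chi> m0 m1 x"
    by (rule pullback_ex[OF lim, of \<chi> m0]) simp_all
  note [simp] = pullback_arr(3,4)[OF M1]
  have [simp]: "Cod C m1 = Cod C m" "Cod C x = Cod C j0" "Dom C x = Dom C m1"
    using pullback_arr(6-8)[OF M1] by simp_all
  have m1: "mono_arr C m1" using pullback_mono[OF M1 M_mono[OF g(3)]] .
  \<comment> \<open>\<open>m1\<close> pulls \<open>m0\<close> back along \<chi>, and
    \<open>m0\<close> pulls \<open>true\<close> back along \<open>k\<close>; so \<open>m1\<close> is
    the closure of the subobject, and it remains to identify it with \<open>m\<close>.\<close>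
  have c: "is_char C t m1 (k \<cdot> \<chi>)"
    unfolding is_char_def using pullback_paste[OF K M1] by blast
  obtain y where y [simp]: "y \<in> Arr C" "Dom C y = Dom C e" "Cod C y = Dom C m1"
      and my: "m1 \<cdot> y = m \<cdot> (j \<cdot> e)" and xy: "x \<cdot> y = j0 \<cdot> (e0 \<cdot> q)"
    by (rule pullback_lift[OF M1 _ _ _ _ _ sq]) simp_all
  \<comment> \<open>\<open>true = m0 (j0 e0)\<close> is pulled back along \<chi> in two stages. The
    upper stage is this square, so stability of \<J> \<E> factors the inclusion \<open>y\<close> of
    the subobject into its closure.\<close>
  have "is_pullback C (j0 \<cdot> e0) x q y"
  proof (rule is_pullbackI)
    fix v u assume [simp]: "v \<in> Arr C" "u \<in> Arr C" "Dom C u = Dom C v" and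
      "Cod C v = Dom C (j0 \<cdot> e0)" "Cod C u = Dom C x" and vu: "(j0 \<cdot> e0) \<cdot> v = x \<cdot> u"
    then have [simp]: "Cod C v = Dom C e0" "Cod C u = Dom C m1" by simp_all
    have "\<chi> \<cdot> (m1 \<cdot> u) = m0 \<cdot> (x \<cdot> u)"
      by (rule comp_reassoc[OF pullback_arr(9)[OF M1]]) simp_all
    also have "\<dots> = t \<cdot> v" unfolding vu[symmetric] g(6) by simp
    finally have e: "\<chi> \<cdot> (m1 \<cdot> u) = t \<cdot> v" .
    obtain h where h [simp]: "h \<in> Arr C" "Dom C h = Dom C v" "Cod C h = Dom C e"
      and mh: "(m \<cdot> (j \<cdot> e)) \<cdot> h = m1 \<cdot> u" and qh: "q \<cdot> h = v"
      by (rule pullback_lift[OF P _ _ _ _ _ e]) simp_all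
    have "m1 \<cdot> (y \<cdot> h) = m1 \<cdot> u"
      unfolding mh[symmetric] by (rule comp_reassoc1[OF my]) simp_all
    then have "y \<cdot> h = u" by (rule mono_cancel[OF m1]) simp_all
    then show "\<exists>h \<in> Hom C (Dom C v) (Dom C q). q \<cdot> h = v \<and> y \<cdot> h = u"
      using qh by (intro bexI[of _ h]) simp_all
  next
    fix h h' assume h: "h \<in> Arr C" "h' \<in> Arr C" "Dom C h' = Dom C h" "Cod C h = Dom C q"
      "Cod C h' = Dom C q" "q \<cdot> h = q \<cdot> h'" "y \<cdot> h = y \<cdot> h'"
    have "(m1 \<cdot> y) \<cdot> h = (m1 \<cdot> y) \<cdot> h'" using h by simp
    then show "h = h'" unfolding my
      by (intro pullback_eq[OF P, of h h']) (use h in simp_all)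
  qed (simp_all add: xy)
  then have "y \<in> class_comp C \<J> \<E>"
    using JE_stable f g(1,2,4) unfolding pullback_stable_def class_comp_def by blast
  then obtain e1 j1 where y1: "e1 \<in> \<E>" "j1 \<in> \<J>" "Dom C j1 = Cod C e1" "y = j1 \<cdot> e1"
    unfolding class_comp_def by blast
  have [simp]: "e1 \<in> Arr C" "j1 \<in> Arr C" using y1 by simp_all
  have d [simp]: "Dom C e1 = Dom C e" "Cod C j1 = Dom C m1" using y(2,3) y1(3) unfolding y1(4) by simp_all
  \<comment> \<open>\<open>m1 j1 e1\<close> and \<open>m j e\<close> are the same arrow, so the
    diagonal compares \<open>m1\<close> with \<open>m\<close>.\<close>
  have le1: "sub_le C m1 m"
    by (rule factorization_sub_le[OF y1(1,2) _ y1(3) _ f(2,3), of _ e]) (use my y1 in simp_all)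
  \<comment> \<open>Conversely, the diagonal sends \<open>\<chi> \<cdot> m\<close> through
    \<open>m0\<close>, and the pullback defining \<open>m1\<close> turns this into a map from
    \<open>m\<close> to \<open>m1\<close>.\<close>
  have "sub_le C (\<chi> \<cdot> m) m0"
    by (rule factorization_sub_le[OF f(1,2) _ _ _ g(2,3), of _ "e0 \<cdot> q"]) (simp_all add: sq)
  then obtain h where h [simp]: "h \<in> Arr C" "Dom C h = Dom C m" "Cod C h = Dom C m0" and mh: "\<chi> \<cdot> m = m0 \<cdot> h"
    unfolding sub_le_def by auto
  obtain l where "l \<in> Arr C" "Dom C l = Dom C m" "Cod C l = Dom C m1" "m1 \<cdot> l = m"
    by (rule pullback_lift[OF M1 _ _ _ _ _ mh]) simp_all
  then have le2: "sub_le C m m1" unfolding sub_le_def by (intro conjI bexI[of _ l]) simp_all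
  show ?thesis by (rule char_iso[OF c m1 M_mono[OF f(3)] le1 le2])
qed

end

section \<open>Coalgebras\<close>

context comonad
begin

abbreviation "CG \<equiv> Coalg C G \<epsilon> \<delta>"
abbreviation "U \<equiv> ArrMap Forget"

sublocale coalg: category CG
  by (rule category_Coalg)

lemma counit_comult_arr [simp]:
  assumes "A \<in> Obj C"
  shows "\<epsilon> A \<in> Arr C" "Dom C (\<epsilon> A) = ObjMap G A" "Cod C (\<epsilon> A) = A"
    "\<delta> A \<in> Arr C" "Dom C (\<delta> A) = ObjMap G A" "Cod C (\<delta> A) = ObjMap G (ObjMap G A)"
  using counit_in_Hom[OF assms] comult_in_Hom[OF assms] by simp_all

lemma naturality:
  assumes "f \<in> Arr C" 
  shows "Cod C f = B \<Longrightarrow> \<epsilon> B \<cdot> ArrMap G f = f \<cdot> \<epsilon> (Dom C f)"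
    "Cod C f = B \<Longrightarrow> \<delta> B \<cdot> ArrMap G f = ArrMap G (ArrMap G f) \<cdot> \<delta> (Dom C f)"
  using counit_natural[of f "Dom C f" "Cod C f"] comult_natural[of f "Dom C f" "Cod C f"] assms
  by auto

lemma coalg_obj [simp]:
  assumes "X \<in> Obj CG"
  shows "fst X \<in> Obj C" "snd X \<in> Arr C" "Dom C (snd X) = fst X" "Cod C (snd X) = ObjMap G (fst X)"
    "\<epsilon> (fst X) \<cdot> snd X = Id C (fst X)" "\<delta> (fst X) \<cdot> snd X = ArrMap G (snd X) \<cdot> snd X"
  using assms by (auto simp: Coalg_def is_coalgebra_def)

lemma coalg_objI:
  assumes "a \<in> Arr C" "Cod C a = ObjMap G (Dom C a)" "\<epsilon> (Dom C a) \<cdot> a = Id C (Dom C a)"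
    "\<delta> (Dom C a) \<cdot> a = ArrMap G a \<cdot> a"
  shows "(Dom C a, a) \<in> Obj CG"
  using assms by (simp add: Coalg_def is_coalgebra_def)

lemma cofree_obj [simp]: "A \<in> Obj C \<Longrightarrow> cofree G \<delta> A \<in> Obj CG"
  using coalg_objI[of "\<delta> A"] by (simp add: cofree_def counit_left coassociative)

lemma coalg_arr [simp]:
  assumes "a \<in> Arr CG"
  shows "U a \<in> Arr C" "Dom C (U a) = fst (Dom CG a)" "Cod C (U a) = fst (Cod CG a)"
  using assms by (auto simp: Coalg_def Forget_def)

lemma coalg_arr_law:
  "a \<in> Arr CG \<Longrightarrow> Dom CG a = X \<Longrightarrow> Cod CG a = Y \<Longrightarrow> snd Y \<cdot> U a = ArrMap G (U a) \<cdot> snd X"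
  by (auto simp: Coalg_def Forget_def)

lemma coalg_comp [simp]: "U (b \<cdot>\<^bsub>CG\<^esub> a) = U b \<cdot> U a"
  by (auto simp: Coalg_def Forget_def split: prod.splits)

lemma coalg_id [simp]: "U (Id CG X) = Id C (fst X)"
  by (auto simp: Coalg_def Forget_def)

lemma coalg_arr_eqI:
  assumes "a \<in> Arr CG" "b \<in> Arr CG" "Dom CG a = Dom CG b" "Cod CG a = Cod CG b" "U a = U b"
  shows "a = b"
  using assms by (auto simp: Coalg_def Forget_def)

lemma coalg_arr_ex:
  assumes "X \<in> Obj CG" "Y \<in> Obj CG" "f \<in> Arr C" "Dom C f = fst X" "Cod C f = fst Y"
    "snd Y \<cdot> f = ArrMap G f \<cdot> snd X"
  obtains a where "a \<in> Arr CG" "Dom CG a = X" "Cod CG a = Y" "U a = f"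
  by (rule that[of "(X, f, Y)"]) (use assms in \<open>(cases X; cases Y; simp add: Coalg_def Forget_def)+\<close>)

end

context cartesian_comonad
begin

section \<open>Pullbacks of coalgebras\<close>

lemma G_pullback: "is_pullback C f g p q \<Longrightarrow> is_pullback C (ArrMap G f) (ArrMap G g) (ArrMap G p) (ArrMap G q)"
  by (rule preserves_pullback[OF preserves])

text \<open>The lift found in \<open>C\<close> is a coalgebra morphism: the required equation lands
  in \<open>G\<close> of the pullback, which is again a pullback, so it may be tested on the two
  projections, where it reduces to the laws for \<open>x\<close> and \<open>y\<close>.\<close>

lemma reflect_pullback:
  assumes [simp]: "f \<in> Arr CG" "g \<in> Arr CG" "p \<in> Arr CG" "q \<in> Arr CG"
    and dc [simp]: "Cod CG g = Cod CG f" "Cod CG p = Dom CG f" "Cod CG q = Dom CG g" "Dom CG q = Dom CG p"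
    and P: "is_pullback C (U f) (U g) (U p) (U q)"
  shows "is_pullback CG f g p q"
proof (rule coalg.is_pullbackI)
  show "f \<cdot>\<^bsub>CG\<^esub> p = g \<cdot>\<^bsub>CG\<^esub> q"
    by (rule coalg_arr_eqI) (simp_all add: source.pullback_arr(9)[OF P])
  fix x y assume [simp]: "x \<in> Arr CG" "y \<in> Arr CG" "Dom CG y = Dom CG x" "Cod CG x = Dom CG f"
    "Cod CG y = Dom CG g" and e: "f \<cdot>\<^bsub>CG\<^esub> x = g \<cdot>\<^bsub>CG\<^esub> y"
  have e': "U f \<cdot> U x = U g \<cdot> U y" using arg_cong[OF e, of U] by simp
  obtain h where h [simp]: "h \<in> Arr C" "Dom C h = fst (Dom CG x)" "Cod C h = fst (Dom CG p)"
    and ph: "U p \<cdot> h = U x" and qh: "U q \<cdot> h = U y"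
    by (rule source.pullback_lift[OF P _ _ _ _ _ e']) simp_all
  have lift: "ArrMap G (U r) \<cdot> (snd (Dom CG p) \<cdot> h) = ArrMap G (U r) \<cdot> (ArrMap G h \<cdot> snd (Dom CG x))"
    if [simp]: "r \<in> Arr CG" "z \<in> Arr CG" "Dom CG r = Dom CG p" "Dom CG z = Dom CG x" "Cod CG z = Cod CG r"
      and rh: "U r \<cdot> h = U z" for r z
  proof -
    have "ArrMap G (U r) \<cdot> (snd (Dom CG p) \<cdot> h) = snd (Cod CG r) \<cdot> (U r \<cdot> h)"
      by (rule source.comp_reassoc[OF coalg_arr_law[symmetric]]) simp_all
    also have "\<dots> = ArrMap G (U z) \<cdot> snd (Dom CG x)"
      unfolding rh by (rule coalg_arr_law) simp_all
    finally show ?thesis unfolding rh[symmetric] by simp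
  qed
  have e'': "snd (Dom CG p) \<cdot> h = ArrMap G h \<cdot> snd (Dom CG x)"
  proof (rule source.pullback_eq[OF G_pullback[OF P]])
    show "ArrMap G (U p) \<cdot> (snd (Dom CG p) \<cdot> h) = ArrMap G (U p) \<cdot> (ArrMap G h \<cdot> snd (Dom CG x))"
      by (rule lift[OF _ _ _ _ _ ph]) simp_all
    show "ArrMap G (U q) \<cdot> (snd (Dom CG p) \<cdot> h) = ArrMap G (U q) \<cdot> (ArrMap G h \<cdot> snd (Dom CG x))"
      by (rule lift[OF _ _ _ _ _ qh]) simp_all
  qed simp_all
  obtain z where z [simp]: "z \<in> Arr CG" "Dom CG z = Dom CG x" "Cod CG z = Dom CG p" "U z = h"
    by (rule coalg_arr_ex[OF _ _ _ _ _ e'']) simp_all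
  have "p \<cdot>\<^bsub>CG\<^esub> z = x" "q \<cdot>\<^bsub>CG\<^esub> z = y"
    by (rule coalg_arr_eqI; simp add: ph qh)+
  then show "\<exists>h \<in> Hom CG (Dom CG x) (Dom CG p). p \<cdot>\<^bsub>CG\<^esub> h = x \<and> q \<cdot>\<^bsub>CG\<^esub> h = y"
    by (intro bexI[of _ z]) simp_all
next
  fix h h' assume h [simp]: "h \<in> Arr CG" "h' \<in> Arr CG" "Dom CG h' = Dom CG h" "Cod CG h = Dom CG p"
    "Cod CG h' = Dom CG p" and e: "p \<cdot>\<^bsub>CG\<^esub> h = p \<cdot>\<^bsub>CG\<^esub> h'" "q \<cdot>\<^bsub>CG\<^esub> h = q \<cdot>\<^bsub>CG\<^esub> h'"
  show "h = h'"
  proof (rule coalg_arr_eqI)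
    show "U h = U h'"
      by (rule source.pullback_eq[OF P]) (use arg_cong[OF e(1), of U] arg_cong[OF e(2), of U] in simp_all)
  qed simp_all
qed simp_all

text \<open>The structure map on the pullback object is the lift of \<open>\<phi> \<cdot> p'\<close>
  and \<open>\<gamma> \<cdot> q'\<close> through the \<open>G\<close>-image of the square. The
  counit law is tested on the square itself, coassociativity on its image under \<open>G\<close>
  applied twice.\<close>

lemma create_pullback:
  assumes [simp]: "f \<in> Arr CG" "g \<in> Arr CG" "Cod CG g = Cod CG f"
    and P: "is_pullback C (U f) (U g) p' q'"
  obtains p q where "is_pullback CG f g p q" "U p = p'" "U q = q'"
proof -
  note [simp] = source.pullback_arr(3,4)[OF P]
  define A where "A = Dom C p'"
  have [simp]: "Cod C p' = fst (Dom CG f)" "Cod C q' = fst (Dom CG g)" "Dom C q' = A" "Dom C p' = A" "A \<in> Obj C"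
    using source.pullback_arr(6-8)[OF P] by (simp_all add: A_def)
  define \<phi> \<gamma> where "\<phi> = snd (Dom CG f)" "\<gamma> = snd (Dom CG g)"
  have [simp]: "\<phi> \<in> Arr C" "Dom C \<phi> = fst (Dom CG f)" "Cod C \<phi> = ObjMap G (fst (Dom CG f))"
    "\<gamma> \<in> Arr C" "Dom C \<gamma> = fst (Dom CG g)" "Cod C \<gamma> = ObjMap G (fst (Dom CG g))"
    unfolding \<phi>_\<gamma>_def by simp_all
  have "ArrMap G (U f) \<cdot> (\<phi> \<cdot> p') = snd (Cod CG f) \<cdot> (U f \<cdot> p')"
    unfolding \<phi>_\<gamma>_def by (rule source.comp_reassoc[OF coalg_arr_law[symmetric]]) simp_all
  also have "\<dots> = snd (Cod CG g) \<cdot> (U g \<cdot> q')"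
    by (simp add: source.pullback_arr(9)[OF P])
  also have "\<dots> = ArrMap G (U g) \<cdot> (\<gamma> \<cdot> q')"
    unfolding \<phi>_\<gamma>_def by (rule source.comp_reassoc[OF coalg_arr_law]) simp_all
  finally have e: "ArrMap G (U f) \<cdot> (\<phi> \<cdot> p') = ArrMap G (U g) \<cdot> (\<gamma> \<cdot> q')" .
  obtain \<pi> where \<pi> [simp]: "\<pi> \<in> Arr C" "Dom C \<pi> = A" "Cod C \<pi> = ObjMap G A"
    and p\<pi>: "ArrMap G p' \<cdot> \<pi> = \<phi> \<cdot> p'" and q\<pi>: "ArrMap G q' \<cdot> \<pi> = \<gamma> \<cdot> q'"
    by (rule source.pullback_lift[OF G_pullback[OF P] _ _ _ _ _ e]) simp_all
  have counit: "r \<cdot> (\<epsilon> A \<cdot> \<pi>) = r"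
    if [simp]: "r \<in> Arr C" "Dom C r = A" "Cod C r = fst X" "X \<in> Obj CG" and r: "ArrMap G r \<cdot> \<pi> = snd X \<cdot> r" for r X
  proof -
    have "r \<cdot> (\<epsilon> A \<cdot> \<pi>) = \<epsilon> (fst X) \<cdot> (ArrMap G r \<cdot> \<pi>)"
      by (rule source.comp_reassoc) (simp_all add: naturality)
    also have "\<dots> = Id C (fst X) \<cdot> r"
      unfolding r by (rule source.comp_reassoc1) simp_all
    finally show ?thesis by simp
  qed
  have coassoc: "ArrMap G (ArrMap G r) \<cdot> (\<delta> A \<cdot> \<pi>) = ArrMap G (ArrMap G r) \<cdot> (ArrMap G \<pi> \<cdot> \<pi>)"
    if [simp]: "r \<in> Arr C" "Dom C r = A" "Cod C r = fst X" "X \<in> Obj CG" and r: "ArrMap G r \<cdot> \<pi> = snd X \<cdot> r" for r X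
  proof -
    have "ArrMap G (ArrMap G r) \<cdot> (\<delta> A \<cdot> \<pi>) = \<delta> (fst X) \<cdot> (ArrMap G r \<cdot> \<pi>)"
      by (rule source.comp_reassoc) (simp_all add: naturality)
    also have "\<dots> = ArrMap G (snd X) \<cdot> (snd X \<cdot> r)"
      unfolding r by (rule source.comp_reassoc) simp_all
    also have "\<dots> = ArrMap G (snd X \<cdot> r) \<cdot> \<pi>" unfolding r[symmetric] by (simp add: r)
    also have "\<dots> = ArrMap G (ArrMap G r) \<cdot> (ArrMap G \<pi> \<cdot> \<pi>)"
      unfolding r[symmetric] by simp
    finally show ?thesis .
  qed
  have X: "(A, \<pi>) \<in> Obj CG"
  proof (rule coalg_objI[of \<pi>, simplified])
    show "\<epsilon> A \<cdot> \<pi> = Id C A"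
    proof (rule source.pullback_eq[OF P])
      show "p' \<cdot> (\<epsilon> A \<cdot> \<pi>) = p' \<cdot> Id C A"
        using counit[of p' "Dom CG f"] p\<pi> by (simp add: \<phi>_\<gamma>_def)
      show "q' \<cdot> (\<epsilon> A \<cdot> \<pi>) = q' \<cdot> Id C A"
        using counit[of q' "Dom CG g"] q\<pi> by (simp add: \<phi>_\<gamma>_def)
    qed simp_all
    show "\<delta> A \<cdot> \<pi> = ArrMap G \<pi> \<cdot> \<pi>"
    proof (rule source.pullback_eq[OF G_pullback[OF G_pullback[OF P]]])
      show "ArrMap G (ArrMap G p') \<cdot> (\<delta> A \<cdot> \<pi>) = ArrMap G (ArrMap G p') \<cdot> (ArrMap G \<pi> \<cdot> \<pi>)"
        by (rule coassoc[of _ "Dom CG f"]) (use p\<pi> in \<open>simp_all add: \<phi>_\<gamma>_def\<close>)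
      show "ArrMap G (ArrMap G q') \<cdot> (\<delta> A \<cdot> \<pi>) = ArrMap G (ArrMap G q') \<cdot> (ArrMap G \<pi> \<cdot> \<pi>)"
        by (rule coassoc[of _ "Dom CG g"]) (use q\<pi> in \<open>simp_all add: \<phi>_\<gamma>_def\<close>)
    qed simp_all
  qed
  obtain p where p [simp]: "p \<in> Arr CG" "Dom CG p = (A, \<pi>)" "Cod CG p = Dom CG f" "U p = p'"
    by (rule coalg_arr_ex[of "(A, \<pi>)" "Dom CG f" p']) (use X p\<pi> in \<open>simp_all add: \<phi>_\<gamma>_def\<close>)
  obtain q where q [simp]: "q \<in> Arr CG" "Dom CG q = (A, \<pi>)" "Cod CG q = Dom CG g" "U q = q'"
    by (rule coalg_arr_ex[of "(A, \<pi>)" "Dom CG g" q']) (use X q\<pi> in \<open>simp_all add: \<phi>_\<gamma>_def\<close>)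
  have "is_pullback CG f g p q"
    by (rule reflect_pullback) (simp_all add: P)
  then show thesis using that by simp
qed

text \<open>The given square is isomorphic to one created over a pullback in \<open>C\<close>, and
  isomorphisms of coalgebras are isomorphisms in \<open>C\<close>.\<close>

lemma preserve_pullback:
  assumes lim: "has_finite_limits C" and P: "is_pullback CG f g p q"
  shows "is_pullback C (U f) (U g) (U p) (U q)"
proof -
  note a [simp] = coalg.pullback_arr(1-8)[OF P]
  obtain p' q' where P': "is_pullback C (U f) (U g) p' q'"
    by (rule source.pullback_ex[OF lim, of "U f" "U g"]) simp_all
  obtain p2 q2 where P2: "is_pullback CG f g p2 q2" "U p2 = p'" "U q2 = q'"
    by (rule create_pullback[OF _ _ _ P']) simp_all
  note b [simp] = coalg.pullback_arr(1-8)[OF P2(1)]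
  obtain h h' where h [simp]: "h \<in> Arr CG" "h' \<in> Arr CG" "Dom CG h = Cod CG h'" "Dom CG h' = Cod CG h"
    "Cod CG h = Dom CG p2" and hh: "h \<cdot>\<^bsub>CG\<^esub> h' = Id CG (Cod CG h)" "h' \<cdot>\<^bsub>CG\<^esub> h = Id CG (Dom CG h)"
    "p2 \<cdot>\<^bsub>CG\<^esub> h = p" "q2 \<cdot>\<^bsub>CG\<^esub> h = q"
    by (rule coalg.pullbacks_iso[OF P2(1) P])
  have "is_pullback C (U f) (U g) (p' \<cdot> U h) (q' \<cdot> U h)"
    by (rule source.pullback_iso[OF P', of _ "U h'"])
      (use arg_cong[OF hh(1), of U] arg_cong[OF hh(2), of U] P2(2) in auto)
  then show ?thesis
    using arg_cong[OF hh(3), of U] arg_cong[OF hh(4), of U] P2(2,3) by simp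
qed

text \<open>\<open>G T\<close> and \<open>G (G T)\<close> are terminal in \<open>C\<close>, so the
  underlying arrow is unique and its coalgebra square commutes automatically.\<close>

lemma terminal_cofree:
  assumes T: "terminal_obj C T"
  shows "terminal_obj CG (cofree G \<delta> T)"
  unfolding terminal_obj_def
proof (intro conjI ballI)
  have [simp]: "T \<in> Obj C" using T by (simp add: terminal_obj_def)
  show "cofree G \<delta> T \<in> Obj CG" by simp
  note GT = preserves_terminal[OF preserves T]
  have [simp]: "fst (cofree G \<delta> T) = ObjMap G T" "snd (cofree G \<delta> T) = \<delta> T" by (simp_all add: cofree_def)
  fix X assume X: "X \<in> Obj CG"
  then obtain f where f: "f \<in> Arr C" "Dom C f = fst X" "Cod C f = ObjMap G T"
    using source.terminal_arr[OF GT, of "fst X"] by auto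
  have e: "\<delta> T \<cdot> f = ArrMap G f \<cdot> snd X"
    by (rule source.terminal_eq[OF preserves_terminal[OF preserves GT]]) (use X f in simp_all)
  obtain a where a: "a \<in> Arr CG" "Dom CG a = X" "Cod CG a = cofree G \<delta> T"
    by (rule coalg_arr_ex[of X "cofree G \<delta> T" f]) (use X f e in simp_all)
  show "\<exists>!h. h \<in> Hom CG X (cofree G \<delta> T)"
  proof (rule ex1I[of _ a])
    fix b assume b: "b \<in> Hom CG X (cofree G \<delta> T)"
    show "b = a"
    proof (rule coalg_arr_eqI)
      show "U b = U a" by (rule source.terminal_eq[OF GT]) (use a b in simp_all)
    qed (use a b in simp_all)
  qed (use a in simp)
qed

text \<open>The product is a pullback over the cofree coalgebra on \<open>T\<close>, whose
  underlying object \<open>G T\<close> is terminal in \<open>C\<close>.\<close>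

lemma preserve_product:
  assumes lim: "has_finite_limits C" and T: "terminal_obj C T" and P: "is_product CG X Y p q"
  shows "is_product C (fst X) (fst Y) (U p) (U q)"
proof -
  note GT = terminal_cofree[OF T]
  note [simp] = coalg.product_arr[OF P]
  have XY: "X \<in> Obj CG" "Y \<in> Obj CG"
    using coalg.dom_cod_obj(2)[of p] coalg.dom_cod_obj(2)[of q] by simp_all
  obtain a where a [simp]: "a \<in> Arr CG" "Dom CG a = X" "Cod CG a = cofree G \<delta> T"
    by (rule coalg.terminal_arr[OF GT XY(1)])
  obtain b where b [simp]: "b \<in> Arr CG" "Dom CG b = Y" "Cod CG b = cofree G \<delta> T"
    by (rule coalg.terminal_arr[OF GT XY(2)])
  have "is_pullback CG a b p q"
    using coalg.product_iff_pullback[OF GT, of a X b Y p q] P by simp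
  then have "is_pullback C (U a) (U b) (U p) (U q)" by (rule preserve_pullback[OF lim])
  then show ?thesis
    using source.product_iff_pullback[OF preserves_terminal[OF preserves T], of "U a" "fst X" "U b" "fst Y" "U p" "U q"]
    by (simp add: cofree_def)
qed

end

section \<open>The topology generated on coalgebras\<close>

lemma left_inducedD: "f \<in> left_induced C G \<epsilon> \<delta> \<A> \<Longrightarrow> f \<in> Arr (Coalg C G \<epsilon> \<delta>)"
  "f \<in> left_induced C G \<epsilon> \<delta> \<A> \<Longrightarrow> ArrMap Forget f \<in> \<A>"
  by (simp_all add: left_induced_def)

text \<open>The data of \<open>is_coalg_omega\<close> are unpacked so that \<tau> has a name and the
  equalizer property can be cited separately.\<close>

locale topos_dfs_comonad = cartesian_comonad C G \<epsilon> \<delta> + cartesian_dfs C \<E> \<J> \<M>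
  for C :: "('o, 'a) precategory" (structure) and G \<epsilon> \<delta> \<E> \<J> \<M> +
  fixes t k \<tau> :: 'a and mG tG :: "('o, 'a) coalg_arr"
  assumes topos: "topos C" and t: "subobject_classifier C t" and gen: "generates_topology C t \<E> \<J> \<M> k"
    and cont: "continuous_functor C t k G"
    and GM: "ArrMap G ` \<M> \<subseteq> \<M>" and GJ: "ArrMap G ` \<J> \<subseteq> \<J>"
    and mG: "mG \<in> Arr (Coalg C G \<epsilon> \<delta>)" "Cod (Coalg C G \<epsilon> \<delta>) mG = cofree G \<delta> (Cod C t)"
    and \<tau>: "is_char C t (ArrMap G t) \<tau>"
    and mG_eq: "is_equalizer C (Id C (ObjMap G (Cod C t))) (ArrMap G \<tau> \<cdot> \<delta> (Cod C t)) (ArrMap Forget mG)"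
    and tG: "is_coalg_true C G \<epsilon> \<delta> t mG tG"
begin

abbreviation "\<Omega> \<equiv> Cod C t"
abbreviation "\<Omega>G \<equiv> Dom CG mG"
abbreviation "\<phi> \<equiv> \<tau> \<cdot> U mG"

lemma lim: "has_finite_limits C"
  using topos by (simp add: topos_def)

lemma G_JM: "j \<in> \<J> \<Longrightarrow> ArrMap G j \<in> \<J>" "m \<in> \<M> \<Longrightarrow> ArrMap G m \<in> \<M>"
  using GJ GM by blast+

lemma t_arr [simp]: "t \<in> Arr C" and t_terminal: "terminal_obj C (Dom C t)"
  using t by (simp_all add: subobject_classifier_def)

lemma t_mono: "mono_arr C t"
  by (rule source.terminal_mono[OF t_terminal t_arr])

lemma \<tau>_arr [simp]: "\<tau> \<in> Arr C" "Dom C \<tau> = ObjMap G \<Omega>" "Cod C \<tau> = \<Omega>"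
proof -
  obtain q where "is_pullback C \<tau> t (ArrMap G t) q" using \<tau> unfolding is_char_def by blast
  from source.pullback_arr[OF this] show "\<tau> \<in> Arr C" "Dom C \<tau> = ObjMap G \<Omega>" "Cod C \<tau> = \<Omega>" by simp_all
qed

lemma k_arr [simp]: "k \<in> Arr C" "Dom C k = \<Omega>" "Cod C k = \<Omega>"
  and k_idem: "k \<cdot> k = k" and k_true: "k \<cdot> t = t"
  using gen unfolding generates_topology_def lawvere_tierney_def by auto

lemma mG_arr [simp]: "mG \<in> Arr CG" "Cod CG mG = cofree G \<delta> \<Omega>" "U mG \<in> Arr C" "Dom C (U mG) = fst \<Omega>G"
  "Cod C (U mG) = ObjMap G \<Omega>" "\<Omega>G \<in> Obj CG"
  using mG coalg_arr[of mG] by (simp_all add: cofree_def)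

lemma tG_arr [simp]: "tG \<in> Arr CG" "Dom CG tG = cofree G \<delta> (Dom C t)" "Cod CG tG = \<Omega>G"
  and mG_tG: "U mG \<cdot> U tG = ArrMap G t"
  using tG unfolding is_coalg_true_def by auto

lemma fst_cofree [simp]: "fst (cofree G \<delta> A) = ObjMap G A" "snd (cofree G \<delta> A) = \<delta> A"
  by (simp_all add: cofree_def)

lemma mG_equalizes: "ArrMap G \<tau> \<cdot> (\<delta> \<Omega> \<cdot> U mG) = U mG"
proof -
  have "(ArrMap G \<tau> \<cdot> \<delta> \<Omega>) \<cdot> U mG = Id C (ObjMap G \<Omega>) \<cdot> U mG"
    using mG_eq unfolding is_equalizer_def by (elim conjE) (rule sym)
  then show ?thesis by simp
qed

lemma mG_lift:
  assumes "x \<in> Arr C" "Cod C x = ObjMap G \<Omega>" "ArrMap G \<tau> \<cdot> (\<delta> \<Omega> \<cdot> x) = x"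
  shows "\<exists>!h. h \<in> Hom C (Dom C x) (fst \<Omega>G) \<and> U mG \<cdot> h = x"
  using source.equalizer_lift[OF mG_eq, of x, unfolded mG_arr(4)] assms(1,2)
  by (simp add: assms(3) del: Hom_def)

lemma mG_mono: "mono_arr C (U mG)"
proof (rule source.mono_arrI)
  fix f g assume [simp]: "f \<in> Arr C" "g \<in> Arr C" "Dom C f = Dom C g" "Cod C f = Dom C (U mG)" "Cod C g = Dom C (U mG)"
    and e: "U mG \<cdot> f = U mG \<cdot> g"
  have "ArrMap G \<tau> \<cdot> (\<delta> \<Omega> \<cdot> (U mG \<cdot> f)) = U mG \<cdot> f"
    using source.comp_reassoc1[OF mG_equalizes, of f] by simp
  then have "\<exists>!h. h \<in> Hom C (Dom C (U mG \<cdot> f)) (fst \<Omega>G) \<and> U mG \<cdot> h = U mG \<cdot> f"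
    by - (rule mG_lift, simp_all)
  moreover have "f \<in> Hom C (Dom C (U mG \<cdot> f)) (fst \<Omega>G)" "g \<in> Hom C (Dom C (U mG \<cdot> f)) (fst \<Omega>G)"
    by simp_all
  ultimately show "f = g" using e by metis
qed simp

text \<open>The two sides classify the \<M>-part \<open>m\<close> of \<open>G(true)\<close> and the
  arrow \<open>G(m0)\<close>, where \<open>m0\<close> is the \<M>-part of \<open>true\<close>. Hence
  they agree once \<open>m\<close> and \<open>G(m0)\<close> are the same subobject.\<close>

lemma k_\<tau>: "k \<cdot> \<tau> = \<tau> \<cdot> ArrMap G k"
proof -
  obtain e0 j0 m0 where g: "e0 \<in> \<E>" "j0 \<in> \<J>" "m0 \<in> \<M>" and d [simp]: "Dom C j0 = Cod C e0" "Dom C m0 = Cod C j0"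
      and t0: "t = m0 \<cdot> (j0 \<cdot> e0)" "is_char C t m0 k"
    using gen unfolding generates_topology_def by blast
  have [simp]: "e0 \<in> Arr C" "j0 \<in> Arr C" "m0 \<in> Arr C" using g by simp_all
  have gG: "ArrMap G j0 \<in> \<J>" "ArrMap G m0 \<in> \<M>" by (simp_all add: g G_JM)
  obtain q0 where K: "is_pullback C k t m0 q0" using t0(2) unfolding is_char_def by blast
  obtain q where T: "is_pullback C \<tau> t (ArrMap G t) q" using \<tau> unfolding is_char_def by blast
  have c1: "is_char C t (ArrMap G m0) (\<tau> \<cdot> ArrMap G k)"
    unfolding is_char_def using source.pullback_paste[OF T G_pullback[OF K]] by blast
  obtain e j m where f: "e \<in> \<E>" "j \<in> \<J>" "m \<in> \<M>" "Dom C j = Cod C e" "Dom C m = Cod C j"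
    and Gt: "ArrMap G t = m \<cdot> (j \<cdot> e)"
    by (rule factorize[of "ArrMap G t"]) simp_all
  have c2: "is_char C t m (k \<cdot> \<tau>)"
    by (rule char_M_part[OF lim t_mono gen f]) (use \<tau> Gt in simp)
  have e: "m \<cdot> (j \<cdot> e) = ArrMap G m0 \<cdot> (ArrMap G j0 \<cdot> ArrMap G e0)"
    unfolding Gt[symmetric] t0(1) by simp
  have [simp]: "Cod C m = ObjMap G (Cod C m0)" "Dom C e = ObjMap G (Dom C e0)"
    using arg_cong[OF e, of "Cod C"] arg_cong[OF e, of "Dom C"] f by simp_all
  \<comment> \<open>\<open>ArrMap G e0\<close> enters as the free arrow \<open>u\<close> of the
    diagonal; only \<open>G(j0)\<close> and \<open>G(m0)\<close> have to lie in \<J> and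
    \<M>.\<close>
  have le1: "sub_le C m (ArrMap G m0)"
    by (rule factorization_sub_le[OF f(1,2) _ f(4,5) gG, of "ArrMap G e0"]) (use f e in simp_all)
  \<comment> \<open>As \<open>char true\<close> is the identity, the closure of \<open>true\<close>
    is classified by \<open>k\<close> itself. Continuity can therefore be applied to the single
    arrow \<open>true\<close>.\<close>
  have "is_closure C t k t m0"
    unfolding is_closure_def is_char_def
    using t_mono source.pullback_id[OF t_arr] K by (metis k_arr(1,2) source.comp_id(1))
  then have "is_closure_of_arr C t k t m0"
    unfolding is_closure_of_arr_def using source.mono_is_image[OF t_mono] by blast
  moreover have Gt_mono: "mono_arr C (ArrMap G t)" by (rule preserves_mono[OF preserves t_mono])
  have "is_closure C t k (ArrMap G t) m"
    unfolding is_closure_def using Gt_mono \<tau> c2 by blast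
  then have "is_closure_of_arr C t k (ArrMap G t) m"
    unfolding is_closure_of_arr_def using source.mono_is_image[OF Gt_mono] by blast
  ultimately have le2: "sub_le C (ArrMap G m0) m"
    using cont t_arr unfolding continuous_functor_def by blast
  have "is_char C t (ArrMap G m0) (k \<cdot> \<tau>)"
    by (rule source.char_iso[OF c2 M_mono[OF f(3)] M_mono[OF gG(2)] le1 le2])
  then show ?thesis using source.char_unique[OF t] c1 by blast
qed

text \<open>A coalgebra morphism \<open>\<chi>\<close> into \<open>\<Omega>\<^sub>G\<close> is recovered from \<open>\<phi> \<chi>\<close>, since
  \<open>m\<^sub>G \<chi> = G(\<phi> \<chi>) \<alpha>\<close> for the structure map \<open>\<alpha>\<close> of its domain.\<close>

lemma \<phi>_faithful:
  assumes [simp]: "\<chi> \<in> Arr CG" "\<chi>' \<in> Arr CG" "Cod CG \<chi> = \<Omega>G" "Cod CG \<chi>' = \<Omega>G" "Dom CG \<chi> = Dom CG \<chi>'"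
    and e: "\<phi> \<cdot> U \<chi> = \<phi> \<cdot> U \<chi>'"
  shows "\<chi> = \<chi>'"
proof -
  have transpose: "U mG \<cdot> U \<psi> = ArrMap G (\<phi> \<cdot> U \<psi>) \<cdot> snd (Dom CG \<psi>)"
    if [simp]: "\<psi> \<in> Arr CG" "Cod CG \<psi> = \<Omega>G" for \<psi>
  proof -
    have "U mG \<cdot> U \<psi> = ArrMap G \<tau> \<cdot> (\<delta> \<Omega> \<cdot> (U mG \<cdot> U \<psi>))"
      using source.comp_reassoc1[OF mG_equalizes, of "U \<psi>"] by simp
    also have "\<delta> \<Omega> \<cdot> (U mG \<cdot> U \<psi>) = ArrMap G (U mG \<cdot> U \<psi>) \<cdot> snd (Dom CG \<psi>)"
      using coalg_arr_law[of "mG \<cdot>\<^bsub>CG\<^esub> \<psi>" "Dom CG \<psi>" "cofree G \<delta> \<Omega>"] by simp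
    also have "ArrMap G \<tau> \<cdot> (ArrMap G (U mG \<cdot> U \<psi>) \<cdot> snd (Dom CG \<psi>)) = ArrMap G (\<phi> \<cdot> U \<psi>) \<cdot> snd (Dom CG \<psi>)"
      by simp
    finally show ?thesis .
  qed
  have "U mG \<cdot> U \<chi> = ArrMap G (\<phi> \<cdot> U \<chi>) \<cdot> snd (Dom CG \<chi>)"
    by (rule transpose) simp_all
  also have "\<dots> = U mG \<cdot> U \<chi>'"
    unfolding e assms(5) by (rule transpose[symmetric]) simp_all
  finally have "U mG \<cdot> U \<chi> = U mG \<cdot> U \<chi>'" .
  then have "U \<chi> = U \<chi>'" by (rule source.mono_cancel[OF mG_mono]) simp_all
  then show ?thesis by - (rule coalg_arr_eqI, simp_all)
qed

text \<open>Because \<open>m\<^sub>G\<close> is monic,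
  \<open>m\<^sub>G true\<^sub>G = G(true)\<close> is a pullback square; pasting it to the square
  defining \<tau> gives the claim.\<close>

lemma \<phi>_char: "is_char C t (U tG) \<phi>"
proof -
  obtain q where T: "is_pullback C \<tau> t (ArrMap G t) q" using \<tau> unfolding is_char_def by blast
  note [simp] = source.pullback_arr(4)[OF T]
  have [simp]: "Dom C q = ObjMap G (Dom C t)" "Cod C q = Dom C t" using source.pullback_arr(7,8)[OF T] by simp_all
  have Gt_mono: "mono_arr C (ArrMap G t)" by (rule preserves_mono[OF preserves t_mono])
  have "is_pullback C (U mG) (ArrMap G t) (U tG) (Id C (ObjMap G (Dom C t)))"
  proof (rule source.is_pullbackI)
    fix x y assume [simp]: "x \<in> Arr C" "y \<in> Arr C" "Dom C y = Dom C x" "Cod C x = Dom C (U mG)" "Cod C y = Dom C (ArrMap G t)"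
      and e: "U mG \<cdot> x = ArrMap G t \<cdot> y"
    have "U mG \<cdot> (U tG \<cdot> y) = U mG \<cdot> x" unfolding e by (rule source.comp_reassoc1[OF mG_tG]) simp_all
    then have "U tG \<cdot> y = x" by (rule source.mono_cancel[OF mG_mono]) simp_all
    then show "\<exists>h \<in> Hom C (Dom C x) (Dom C (U tG)). U tG \<cdot> h = x \<and> Id C (ObjMap G (Dom C t)) \<cdot> h = y"
      by (intro bexI[of _ y]) simp_all
  qed (simp_all add: mG_tG)
  from source.pullback_paste[OF T this] show ?thesis unfolding is_char_def by blast
qed

lemma char_forget:
  assumes "is_char CG tG n \<chi>"
  shows "is_char C t (U n) (\<phi> \<cdot> U \<chi>)"
proof -
  obtain q where P: "is_pullback CG \<chi> tG n q" using assms unfolding is_char_def by blast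
  obtain q' where "is_pullback C \<phi> t (U tG) q'" using \<phi>_char unfolding is_char_def by blast
  from source.pullback_paste[OF this preserve_pullback[OF lim P]] show ?thesis unfolding is_char_def by blast
qed

text \<open>The missing edge of the square, into the cofree coalgebra on 1, exists by terminality.
  Cancelling the square of \<open>\<phi>\<close> from the outer rectangle leaves a pullback in
  \<open>C\<close>, which coalgebras reflect.\<close>

lemma char_reflect:
  assumes [simp]: "\<chi> \<in> Arr CG" "Cod CG \<chi> = \<Omega>G" "n \<in> Arr CG" "Cod CG n = Dom CG \<chi>"
    and "is_char C t (U n) (\<phi> \<cdot> U \<chi>)"
  shows "is_char CG tG n \<chi>"
proof -
  obtain z where Z: "is_pullback C (\<phi> \<cdot> U \<chi>) t (U n) z" using assms(5) unfolding is_char_def by blast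
  obtain q' where P: "is_pullback C \<phi> t (U tG) q'" using \<phi>_char unfolding is_char_def by blast
  note [simp] = source.pullback_arr(4)[OF Z] source.pullback_arr(4)[OF P]
  have [simp]: "Dom C q' = ObjMap G (Dom C t)" "Cod C q' = Dom C t" using source.pullback_arr(7,8)[OF P] by simp_all
  have [simp]: "Dom C z = fst (Dom CG n)" "Cod C z = Dom C t" using source.pullback_arr(7,8)[OF Z] by simp_all
  have "n \<in> Arr CG" by fact
  obtain q where q [simp]: "q \<in> Arr CG" "Dom CG q = Dom CG n" "Cod CG q = cofree G \<delta> (Dom C t)"
    by (rule coalg.terminal_arr[OF terminal_cofree[OF t_terminal], of "Dom CG n"]) simp_all
  have e: "\<phi> \<cdot> (U \<chi> \<cdot> U n) = t \<cdot> z" using source.pullback_arr(9)[OF Z] by simp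
  obtain h where h [simp]: "h \<in> Arr C" "Dom C h = fst (Dom CG n)" "Cod C h = ObjMap G (Dom C t)"
    and th: "U tG \<cdot> h = U \<chi> \<cdot> U n"
    by (rule source.pullback_lift[OF P _ _ _ _ _ e]) simp_all
  \<comment> \<open>The lift in \<open>C\<close> and the coalgebra morphism agree because
    \<open>G 1\<close> is terminal.\<close>
  have hq: "h = U q"
    by (rule source.terminal_eq[OF preserves_terminal[OF preserves t_terminal]]) simp_all
  have zq: "q' \<cdot> U q = z"
    by (rule source.terminal_eq[OF t_terminal]) simp_all
  have "is_pullback C (U \<chi>) (U tG) (U n) (U q)"
    by (rule source.pullback_cancel[OF P Z]) (use th hq zq in simp_all)
  then have "is_pullback CG \<chi> tG n q"
    by (intro reflect_pullback) simp_all
  then show ?thesis unfolding is_char_def by blast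
qed

text \<open>A factorization in \<open>C\<close> of the underlying arrow lifts to coalgebras. This
  supplies the factorization of \<open>true\<^sub>G\<close> whose \<M>-part defines the generated
  topology.\<close>

lemma coalg_factorization:
  assumes [simp]: "f \<in> Arr CG"
  obtains e j m where "e \<in> left_induced C G \<epsilon> \<delta> \<E>" "j \<in> left_induced C G \<epsilon> \<delta> \<J>" "m \<in> left_induced C G \<epsilon> \<delta> \<M>"
    "Dom CG j = Cod CG e" "Dom CG m = Cod CG j" "f = m \<cdot>\<^bsub>CG\<^esub> (j \<cdot>\<^bsub>CG\<^esub> e)"
proof -
  define X Y where "X = Dom CG f" and "Y = Cod CG f"
  define \<xi> \<theta> where "\<xi> = snd X" and "\<theta> = snd Y"
  have XY [simp]: "X \<in> Obj CG" "Y \<in> Obj CG" by (simp_all add: X_def Y_def)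
  have [simp]: "\<xi> \<in> Arr C" "Dom C \<xi> = fst X" "Cod C \<xi> = ObjMap G (fst X)"
    "\<theta> \<in> Arr C" "Dom C \<theta> = fst Y" "Cod C \<theta> = ObjMap G (fst Y)"
    by (simp_all add: \<xi>_def \<theta>_def)
  have ax: "\<epsilon> (fst X) \<cdot> \<xi> = Id C (fst X)" "\<delta> (fst X) \<cdot> \<xi> = ArrMap G \<xi> \<cdot> \<xi>"
    "\<epsilon> (fst Y) \<cdot> \<theta> = Id C (fst Y)" "\<delta> (fst Y) \<cdot> \<theta> = ArrMap G \<theta> \<cdot> \<theta>"
    by (simp_all add: \<xi>_def \<theta>_def)
  obtain e j m where f: "e \<in> \<E>" "j \<in> \<J>" "m \<in> \<M>" and d [simp]: "Dom C j = Cod C e" "Dom C m = Cod C j"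
    and Uf: "U f = m \<cdot> (j \<cdot> e)"
    by (rule factorize[of "U f"]) simp_all
  have [simp]: "e \<in> Arr C" "j \<in> Arr C" "m \<in> Arr C" using f by simp_all
  have [simp]: "Dom C e = fst X" "Cod C m = fst Y"
    using arg_cong[OF Uf, of "Dom C"] arg_cong[OF Uf, of "Cod C"] by (simp_all add: X_def Y_def)
  have fG: "ArrMap G j \<in> \<J>" "ArrMap G m \<in> \<M>" "ArrMap G (ArrMap G j) \<in> \<J>" "ArrMap G (ArrMap G m) \<in> \<M>"
    by (simp_all add: f G_JM)
  have "\<theta> \<cdot> U f = ArrMap G (U f) \<cdot> \<xi>"
    unfolding \<theta>_def \<xi>_def by (rule coalg_arr_law) (simp_all add: X_def Y_def)
  then have sq: "(\<theta> \<cdot> m) \<cdot> (j \<cdot> e) = ArrMap G m \<cdot> (ArrMap G j \<cdot> (ArrMap G e \<cdot> \<xi>))"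
    unfolding Uf by simp
  \<comment> \<open>One diagonal yields both structure maps, \<open>b\<close> and \<open>y\<close>;
    its three equations say that \<open>e\<close>, \<open>j\<close> and \<open>m\<close> are
    coalgebra morphisms.\<close>
  obtain b y where [simp]: "b \<in> Arr C" "y \<in> Arr C" "Dom C b = Cod C e" "Cod C b = ObjMap G (Cod C e)"
      "Dom C y = Cod C j" "Cod C y = ObjMap G (Cod C j)"
    and be: "b \<cdot> e = ArrMap G e \<cdot> \<xi>" and jb: "ArrMap G j \<cdot> b = y \<cdot> j" and my: "ArrMap G m \<cdot> y = \<theta> \<cdot> m"
    by (rule diagonal_fill[OF f(1,2) fG(1,2) _ _ _ _ _ _ _ _ sq]) simp_all
  have nat: "\<epsilon> (Cod C r) \<cdot> (ArrMap G r \<cdot> x) = r \<cdot> (\<epsilon> (Dom C r) \<cdot> x)"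
     "\<delta> (Cod C r) \<cdot> (ArrMap G r \<cdot> x) = ArrMap G (ArrMap G r) \<cdot> (\<delta> (Dom C r) \<cdot> x)"
    if "r \<in> Arr C" "x \<in> Arr C" "Cod C x = ObjMap G (Dom C r)" for r x
    using source.comp_reassoc[OF naturality(1)[of r], of _ x] source.comp_reassoc[OF naturality(2)[of r], of _ x] that
    by simp_all
  \<comment> \<open>The coalgebra axioms hold because both sides are diagonals of the same square.\<close>
  have e1: "(\<epsilon> (Cod C e) \<cdot> b) \<cdot> e = Id C (Cod C e) \<cdot> e"
    using nat(1)[of e \<xi>] by (simp add: be ax)
  have j1: "j \<cdot> (\<epsilon> (Cod C e) \<cdot> b) = (\<epsilon> (Cod C j) \<cdot> y) \<cdot> j"
    using nat(1)[of j b] by (simp add: jb)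
  have m1: "m \<cdot> (\<epsilon> (Cod C j) \<cdot> y) = m \<cdot> Id C (Cod C j)"
    using nat(1)[of m y] source.comp_reassoc1[OF ax(3), of m] by (simp add: my)
  have j0: "j \<cdot> Id C (Cod C e) = Id C (Cod C j) \<cdot> j" by simp
  note c1 = diagonal_unique[OF f(1,2,2,3) _ _ _ _ _ _ e1 j1 j0 m1, simplified]
  have e2: "(\<delta> (Cod C e) \<cdot> b) \<cdot> e = (ArrMap G b \<cdot> b) \<cdot> e"
  proof -
    have "(\<delta> (Cod C e) \<cdot> b) \<cdot> e = ArrMap G (ArrMap G e) \<cdot> (ArrMap G \<xi> \<cdot> \<xi>)"
      using nat(2)[of e \<xi>] by (simp add: be ax)
    also have "\<dots> = ArrMap G (b \<cdot> e) \<cdot> \<xi>" unfolding be by simp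
    also have "\<dots> = (ArrMap G b \<cdot> b) \<cdot> e" by (simp add: be[symmetric])
    finally show ?thesis .
  qed
  have j2: "ArrMap G (ArrMap G j) \<cdot> (\<delta> (Cod C e) \<cdot> b) = (\<delta> (Cod C j) \<cdot> y) \<cdot> j"
    using nat(2)[of j b] by (simp add: jb)
  have j3: "ArrMap G (ArrMap G j) \<cdot> (ArrMap G b \<cdot> b) = (ArrMap G y \<cdot> y) \<cdot> j"
  proof -
    have "ArrMap G (ArrMap G j) \<cdot> (ArrMap G b \<cdot> b) = ArrMap G (ArrMap G j \<cdot> b) \<cdot> b" by simp
    also have "\<dots> = (ArrMap G y \<cdot> y) \<cdot> j" unfolding jb by (simp add: jb)
    finally show ?thesis .
  qed
  have m2: "ArrMap G (ArrMap G m) \<cdot> (\<delta> (Cod C j) \<cdot> y) = ArrMap G (ArrMap G m) \<cdot> (ArrMap G y \<cdot> y)"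
  proof -
    have "ArrMap G (ArrMap G m) \<cdot> (\<delta> (Cod C j) \<cdot> y) = ArrMap G \<theta> \<cdot> (\<theta> \<cdot> m)"
      using nat(2)[of m y] source.comp_reassoc[OF ax(4), of m] by (simp add: my)
    also have "\<dots> = ArrMap G (\<theta> \<cdot> m) \<cdot> y" unfolding my[symmetric] by (simp add: my)
    also have "\<dots> = ArrMap G (ArrMap G m) \<cdot> (ArrMap G y \<cdot> y)" unfolding my[symmetric] by simp
    finally show ?thesis .
  qed
  \<comment> \<open>For coassociativity the right-hand arrows are \<open>G (G j)\<close> and
    \<open>G (G m)\<close>, in \<J> and \<M> by applying the preservation hypotheses twice.\<close>
  note c2 = diagonal_unique[OF f(1,2) fG(3,4) _ _ _ _ _ _ e2 j2 j3 m2, simplified]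
  have B: "(Cod C e, b) \<in> Obj CG" using coalg_objI[of b] c1(1) c2(1) by simp
  have Y': "(Cod C j, y) \<in> Obj CG" using coalg_objI[of y] c1(2) c2(2) by simp
  obtain e' where e' [simp]: "e' \<in> Arr CG" "Dom CG e' = X" "Cod CG e' = (Cod C e, b)" "U e' = e"
    by (rule coalg_arr_ex[of X "(Cod C e, b)" e]) (use B be in \<open>simp_all add: \<xi>_def\<close>)
  obtain j' where j' [simp]: "j' \<in> Arr CG" "Dom CG j' = (Cod C e, b)" "Cod CG j' = (Cod C j, y)" "U j' = j"
    by (rule coalg_arr_ex[of "(Cod C e, b)" "(Cod C j, y)" j]) (use B Y' jb in simp_all)
  obtain m' where m' [simp]: "m' \<in> Arr CG" "Dom CG m' = (Cod C j, y)" "Cod CG m' = Y" "U m' = m"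
    by (rule coalg_arr_ex[of "(Cod C j, y)" Y m]) (use Y' my in \<open>simp_all add: \<theta>_def\<close>)
  have "f = m' \<cdot>\<^bsub>CG\<^esub> (j' \<cdot>\<^bsub>CG\<^esub> e')"
    by (rule coalg_arr_eqI) (simp_all add: Uf X_def[symmetric] Y_def[symmetric])
  then show thesis using that[of e' j' m'] f by (simp add: left_induced_def)
qed

lemma char_factor_tG:
  assumes "e \<in> left_induced C G \<epsilon> \<delta> \<E>" "j \<in> left_induced C G \<epsilon> \<delta> \<J>" "m \<in> left_induced C G \<epsilon> \<delta> \<M>"
    and "Dom CG j = Cod CG e" "Dom CG m = Cod CG j" "tG = m \<cdot>\<^bsub>CG\<^esub> (j \<cdot>\<^bsub>CG\<^esub> e)"
  shows "is_char C t (U m) (k \<cdot> \<phi>)"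
proof (rule char_M_part[OF lim t_mono gen])
  note [simp] = assms(1-3)[THEN left_inducedD(1)]
  show "U e \<in> \<E>" "U j \<in> \<J>" "U m \<in> \<M>" using assms by (auto dest: left_inducedD(2))
  show "is_char C t (U m \<cdot> (U j \<cdot> U e)) \<phi>" using \<phi>_char unfolding assms(6) by simp
qed (use assms(1-3)[THEN left_inducedD(1)] assms in simp_all)

text \<open>\<open>G(k) m\<^sub>G\<close> factors through the equalizer: naturality of \<delta>
  moves \<open>G(k)\<close> past it, and then \<open>\<tau> G(k) = k \<tau>\<close> reduces the
  condition to the one for \<open>m\<^sub>G\<close>.\<close>

lemma extension_ex1: "\<exists>!k'. is_extension C G \<epsilon> \<delta> mG k k'"
proof -
  define \<omega> where "\<omega> = snd \<Omega>G"
  have \<omega> [simp]: "\<omega> \<in> Arr C" "Dom C \<omega> = fst \<Omega>G" "Cod C \<omega> = ObjMap G (fst \<Omega>G)"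
    by (simp_all add: \<omega>_def)
  have law: "\<delta> \<Omega> \<cdot> U mG = ArrMap G (U mG) \<cdot> \<omega>"
    using coalg_arr_law[of mG \<Omega>G "cofree G \<delta> \<Omega>"] by (simp add: \<omega>_def)
  have \<delta>k: "\<delta> \<Omega> \<cdot> (ArrMap G k \<cdot> U mG) = ArrMap G (ArrMap G k) \<cdot> (\<delta> \<Omega> \<cdot> U mG)"
    by (rule source.comp_reassoc) (simp_all add: naturality)
  have "ArrMap G \<tau> \<cdot> (\<delta> \<Omega> \<cdot> (ArrMap G k \<cdot> U mG)) = ArrMap G (\<tau> \<cdot> ArrMap G k) \<cdot> (\<delta> \<Omega> \<cdot> U mG)"
    unfolding \<delta>k by simp
  also have "\<dots> = ArrMap G k \<cdot> U mG"
    unfolding k_\<tau>[symmetric] by (simp add: mG_equalizes)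
  finally have "\<exists>!h. h \<in> Hom C (Dom C (ArrMap G k \<cdot> U mG)) (fst \<Omega>G) \<and> U mG \<cdot> h = ArrMap G k \<cdot> U mG"
    by (intro mG_lift) simp_all
  then obtain h where h [simp]: "h \<in> Arr C" "Dom C h = fst \<Omega>G" "Cod C h = fst \<Omega>G"
    and mh: "U mG \<cdot> h = ArrMap G k \<cdot> U mG" by auto
  \<comment> \<open>The coalgebra law for \<open>h\<close> is checked after the mono
    \<open>G(m\<^sub>G)\<close>, where it becomes naturality of \<delta> at
    \<open>k\<close>.\<close>
  have "ArrMap G (U mG) \<cdot> (\<omega> \<cdot> h) = \<delta> \<Omega> \<cdot> (U mG \<cdot> h)"
    by (rule source.comp_reassoc[OF law[symmetric]]) simp_all
  also have "\<dots> = ArrMap G (U mG \<cdot> h) \<cdot> \<omega>"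
    unfolding mh \<delta>k law by simp
  also have "\<dots> = ArrMap G (U mG) \<cdot> (ArrMap G h \<cdot> \<omega>)" by simp
  finally have law': "\<omega> \<cdot> h = ArrMap G h \<cdot> \<omega>"
    by (rule source.mono_cancel[OF preserves_mono[OF preserves mG_mono]]) simp_all
  obtain k' where k': "k' \<in> Arr CG" "Dom CG k' = \<Omega>G" "Cod CG k' = \<Omega>G" "U k' = h"
    by (rule coalg_arr_ex[OF _ _ _ _ _ law'[unfolded \<omega>_def]]) simp_all
  show ?thesis
  proof (rule ex1I[of _ k'])
    show "is_extension C G \<epsilon> \<delta> mG k k'" unfolding is_extension_def using k' mh by simp
    fix k'' assume "is_extension C G \<epsilon> \<delta> mG k k''"
    then have k'': "k'' \<in> Arr CG" "Dom CG k'' = \<Omega>G" "Cod CG k'' = \<Omega>G" "U mG \<cdot> U k'' = ArrMap G k \<cdot> U mG"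
      unfolding is_extension_def by auto
    have "U k'' = U k'" by (rule source.mono_cancel[OF mG_mono]) (use k' k'' mh in simp_all)
    then show "k'' = k'" by - (rule coalg_arr_eqI, use k' k'' in simp_all)
  qed
qed

section \<open>The extension \<open>k'\<close> is a topology and is the one generated\<close>

context
  fixes k' assumes ext: "is_extension C G \<epsilon> \<delta> mG k k'"
begin

lemma k'_arr [simp]: "k' \<in> Arr CG" "Dom CG k' = \<Omega>G" "Cod CG k' = \<Omega>G"
  using ext unfolding is_extension_def by auto

lemma \<phi>_k': "\<phi> \<cdot> U k' = k \<cdot> \<phi>"
proof -
  have "\<phi> \<cdot> U k' = \<tau> \<cdot> (ArrMap G k \<cdot> U mG)"
    using ext unfolding is_extension_def by simp
  also have "\<dots> = k \<cdot> \<phi>" by (rule source.comp_reassoc[OF k_\<tau>[symmetric]]) simp_all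
  finally show ?thesis .
qed

lemma \<phi>_k'_comp: "x \<in> Arr C \<Longrightarrow> Cod C x = fst \<Omega>G \<Longrightarrow> \<tau> \<cdot> (U mG \<cdot> (U k' \<cdot> x)) = k \<cdot> (\<tau> \<cdot> (U mG \<cdot> x))"
  using source.comp_reassoc[OF \<phi>_k', of x] by simp

lemma generated_eq_extension:
  assumes "generates_topology CG tG (left_induced C G \<epsilon> \<delta> \<E>) (left_induced C G \<epsilon> \<delta> \<J>) (left_induced C G \<epsilon> \<delta> \<M>) kG"
  shows "kG = k'"
proof -
  obtain e j m where f: "e \<in> left_induced C G \<epsilon> \<delta> \<E>" "j \<in> left_induced C G \<epsilon> \<delta> \<J>" "m \<in> left_induced C G \<epsilon> \<delta> \<M>"
    "Dom CG j = Cod CG e" "Dom CG m = Cod CG j" "tG = m \<cdot>\<^bsub>CG\<^esub> (j \<cdot>\<^bsub>CG\<^esub> e)" "is_char CG tG m kG"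
    and kG: "kG \<in> Hom CG (Cod CG tG) (Cod CG tG)"
    using assms unfolding generates_topology_def lawvere_tierney_def by blast
  have "\<phi> \<cdot> U kG = k \<cdot> \<phi>"
    by (rule source.char_unique[OF t char_forget[OF f(7)] char_factor_tG[OF f(1-6)]])
  then show ?thesis by - (rule \<phi>_faithful, use kG \<phi>_k' in simp_all)
qed

text \<open>The meet \<open>w\<close> of coalgebras is carried to the meet \<open>w0\<close> of
  \<open>C\<close> by \<open>\<phi> w = w0 (\<phi> \<times> \<phi>)\<close>, so the law for
  \<open>k'\<close> follows from the law for \<open>k\<close>.\<close>

lemma extension_meet:
  assumes "is_meet CG tG p q w" and kk: "is_product_arr CG p q p q k' k' kk"
  shows "k' \<cdot>\<^bsub>CG\<^esub> w = w \<cdot>\<^bsub>CG\<^esub> kk"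
proof -
  obtain r s tt where P: "is_product CG \<Omega>G \<Omega>G p q"
    and R: "is_product CG (cofree G \<delta> (Dom C t)) (cofree G \<delta> (Dom C t)) r s"
    and tt: "is_product_arr CG r s p q tG tG tt" and w: "is_char CG tG tt w"
    using assms(1) unfolding is_meet_def by auto
  obtain z where "is_pullback CG w tG tt z" using w unfolding is_char_def by blast
  from coalg.pullback_arr[OF this] have [simp]: "w \<in> Arr CG" "Cod CG w = \<Omega>G" "Dom CG w = Cod CG tt" by simp_all
  note [simp] = coalg.product_arr[OF P] coalg.product_arr[OF R] coalg.product_arr_arr(1-3)[OF kk]
    coalg.product_arr_arr(1-3)[OF tt]
  have UP: "is_product C (fst \<Omega>G) (fst \<Omega>G) (U p) (U q)" by (rule preserve_product[OF lim t_terminal P])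
  have UR: "is_product C (ObjMap G (Dom C t)) (ObjMap G (Dom C t)) (U r) (U s)"
    using preserve_product[OF lim t_terminal R] by simp
  have prods: "\<exists>p q. is_product C A B p q" if "A \<in> Obj C" "B \<in> Obj C" for A B
    using topos that unfolding topos_def cartesian_closed_def by blast
  obtain c\<^sub>1 c\<^sub>2 where c: "is_product C \<Omega> \<Omega> c\<^sub>1 c\<^sub>2" using prods by fastforce
  obtain r\<^sub>1 r\<^sub>2 where r: "is_product C (Dom C t) (Dom C t) r\<^sub>1 r\<^sub>2" using prods by fastforce
  note [simp] = source.product_arr[OF c] source.product_arr[OF r]
  obtain tt0 where tt0: "is_product_arr C r\<^sub>1 r\<^sub>2 c\<^sub>1 c\<^sub>2 t t tt0"
    by (rule source.product_arr_ex[OF c r, of t t]) simp_all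
  have "mono_arr C tt0" by (rule source.product_arr_mono[OF c r tt0 t_mono _ t_mono]) simp_all
  then obtain w0 where w0: "is_char C t tt0 w0" using t unfolding subobject_classifier_def by blast
  obtain z0 where W0: "is_pullback C w0 t tt0 z0" using w0 unfolding is_char_def by blast
  obtain ff where ff: "is_product_arr C (U p) (U q) c\<^sub>1 c\<^sub>2 \<phi> \<phi> ff"
    by (rule source.product_arr_ex[OF c UP, of \<phi> \<phi>]) simp_all
  obtain q7 where P7: "is_pullback C \<phi> t (U tG) q7" using \<phi>_char unfolding is_char_def by blast
  have [simp]: "q7 \<in> Arr C" "Dom C q7 = ObjMap G (Dom C t)" "Cod C q7 = Dom C t"
    using source.pullback_arr(4,7,8)[OF P7] by simp_all
  obtain qq where qq: "is_product_arr C (U r) (U s) r\<^sub>1 r\<^sub>2 q7 q7 qq"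
    by (rule source.product_arr_ex[OF r UR, of q7 q7]) simp_all
  have Utt: "is_product_arr C (U r) (U s) (U p) (U q) (U tG) (U tG) (U tt)"
    using arg_cong[OF coalg.product_arr_arr(4)[OF tt], of U] arg_cong[OF coalg.product_arr_arr(5)[OF tt], of U]
    by (simp add: is_product_arr_def)
  \<comment> \<open>\<open>ff\<close> is \<open>\<phi> \<times> \<phi>\<close>: the square
    exhibiting the underlying \<open>true\<^sub>G\<close> as a pullback of \<open>true\<close> is
    multiplied with itself.\<close>
  have "is_pullback C ff tt0 (U tt) qq"
    by (rule source.pullback_product[OF P7 _ _ _ _ ff tt0 Utt qq]) (use UP UR c r in simp_all)
  from source.pullback_paste[OF W0 this] have "is_char C t (U tt) (w0 \<cdot> ff)"
    unfolding is_char_def by blast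
  from source.char_unique[OF t char_forget[OF w] this]
  have \<phi>w: "\<phi> \<cdot> U w = w0 \<cdot> ff" .
  have [simp]: "w0 \<in> Arr C" "Dom C w0 = Dom C c\<^sub>1" "Cod C w0 = \<Omega>"
    using source.pullback_arr(1,5,6)[OF W0] source.product_arr_arr(3)[OF tt0] by simp_all
  obtain kkC where kkC: "is_product_arr C c\<^sub>1 c\<^sub>2 c\<^sub>1 c\<^sub>2 k k kkC"
    by (rule source.product_arr_ex[OF c c, of k k]) simp_all
  note [simp] = source.product_arr_arr(1-3)[OF ff] source.product_arr_arr(1-3)[OF kkC]
  have kw0: "k \<cdot> w0 = w0 \<cdot> kkC"
    using gen c r tt0 w0 kkC unfolding generates_topology_def lawvere_tierney_def is_meet_def by blast
  \<comment> \<open>This is \<open>\<phi> k' = k \<phi>\<close> in each coordinate;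
    \<open>proj\<close> treats both projections at once.\<close>
  have kf: "kkC \<cdot> ff = ff \<cdot> U kk"
  proof (rule source.product_eq[OF c])
    have proj: "c \<cdot> (kkC \<cdot> ff) = c \<cdot> (ff \<cdot> U kk)"
      if [simp]: "c \<in> Arr C" "Dom C c = Dom C c\<^sub>1" "Cod C c = \<Omega>" "d \<in> Arr CG" "Dom CG d = Dom CG p" "Cod CG d = \<Omega>G"
        and e: "c \<cdot> kkC = k \<cdot> c" "c \<cdot> ff = \<phi> \<cdot> U d" "d \<cdot>\<^bsub>CG\<^esub> kk = k' \<cdot>\<^bsub>CG\<^esub> d" for c d
    proof -
      have "c \<cdot> (kkC \<cdot> ff) = k \<cdot> (c \<cdot> ff)" by (rule source.comp_reassoc[OF e(1)]) simp_all
      also have "\<dots> = \<phi> \<cdot> (U k' \<cdot> U d)" unfolding e(2) by (simp add: \<phi>_k'_comp)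
      also have "\<dots> = \<phi> \<cdot> (U d \<cdot> U kk)" using arg_cong[OF e(3), of U] by simp
      also have "\<dots> = c \<cdot> (ff \<cdot> U kk)" by (rule source.comp_reassoc[OF e(2)[symmetric]]) simp_all
      finally show ?thesis .
    qed
    show "c\<^sub>1 \<cdot> (kkC \<cdot> ff) = c\<^sub>1 \<cdot> (ff \<cdot> U kk)"
      by (rule proj[of _ p]) (simp_all add: source.product_arr_arr(4)[OF ff] source.product_arr_arr(4)[OF kkC]
          coalg.product_arr_arr(4)[OF kk])
    show "c\<^sub>2 \<cdot> (kkC \<cdot> ff) = c\<^sub>2 \<cdot> (ff \<cdot> U kk)"
      by (rule proj[of _ q]) (simp_all add: source.product_arr_arr(5)[OF ff] source.product_arr_arr(5)[OF kkC]
          coalg.product_arr_arr(5)[OF kk])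
  qed simp_all
  have "\<phi> \<cdot> (U k' \<cdot> U w) = k \<cdot> (\<phi> \<cdot> U w)" by (simp add: \<phi>_k'_comp)
  also have "\<dots> = w0 \<cdot> (kkC \<cdot> ff)" unfolding \<phi>w by (rule source.comp_reassoc[OF kw0]) simp_all
  also have "\<dots> = \<phi> \<cdot> (U w \<cdot> U kk)"
    unfolding kf by (rule source.comp_reassoc[OF \<phi>w[symmetric]]) simp_all
  finally show ?thesis by - (rule \<phi>_faithful, simp_all)
qed

text \<open>Idempotence and \<open>k' true\<^sub>G = true\<^sub>G\<close> are equations between
  coalgebra morphisms into \<open>\<Omega>\<^sub>G\<close>, so \<open>\<phi>_faithful\<close>
  transfers them from \<open>k\<close>.\<close>

lemma extension_lawvere_tierney: "lawvere_tierney CG tG k'"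
proof -
  have "k' \<cdot>\<^bsub>CG\<^esub> k' = k'"
  proof (rule \<phi>_faithful)
    have "\<phi> \<cdot> U (k' \<cdot>\<^bsub>CG\<^esub> k') = k \<cdot> (\<phi> \<cdot> U k')" by (simp add: \<phi>_k'_comp)
    also have "\<dots> = k \<cdot> \<phi>" unfolding \<phi>_k' by (rule source.comp_reassoc1[OF k_idem]) simp_all
    finally show "\<phi> \<cdot> U (k' \<cdot>\<^bsub>CG\<^esub> k') = \<phi> \<cdot> U k'" unfolding \<phi>_k' .
  qed simp_all
  moreover have "k' \<cdot>\<^bsub>CG\<^esub> tG = tG"
  proof (rule \<phi>_faithful)
    obtain q where P: "is_pullback C \<phi> t (U tG) q" using \<phi>_char unfolding is_char_def by blast
    have [simp]: "q \<in> Arr C" "Cod C q = Dom C t" using source.pullback_arr(4,7)[OF P] by simp_all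
    have "\<phi> \<cdot> U (k' \<cdot>\<^bsub>CG\<^esub> tG) = k \<cdot> (\<phi> \<cdot> U tG)" by (simp add: \<phi>_k'_comp)
    also have "\<dots> = \<phi> \<cdot> U tG"
      unfolding source.pullback_arr(9)[OF P] by (rule source.comp_reassoc1[OF k_true]) simp_all
    finally show "\<phi> \<cdot> U (k' \<cdot>\<^bsub>CG\<^esub> tG) = \<phi> \<cdot> U tG" .
  qed simp_all
  ultimately show ?thesis unfolding lawvere_tierney_def
    by (intro conjI allI impI) (simp, blast, blast, blast intro: extension_meet)
qed

lemma extension_generated:
  "generates_topology CG tG (left_induced C G \<epsilon> \<delta> \<E>) (left_induced C G \<epsilon> \<delta> \<J>) (left_induced C G \<epsilon> \<delta> \<M>) k'"
proof -
  obtain e j m where f: "e \<in> left_induced C G \<epsilon> \<delta> \<E>" "j \<in> left_induced C G \<epsilon> \<delta> \<J>" "m \<in> left_induced C G \<epsilon> \<delta> \<M>"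
    "Dom CG j = Cod CG e" "Dom CG m = Cod CG j" "tG = m \<cdot>\<^bsub>CG\<^esub> (j \<cdot>\<^bsub>CG\<^esub> e)"
    by (rule coalg_factorization[of tG]) simp_all
  note [simp] = f(1-3)[THEN left_inducedD(1)] f(4,5)
  have "Cod CG m = \<Omega>G" using arg_cong[OF f(6), of "Cod CG"] by simp
  then have "is_char CG tG m k'"
    by (intro char_reflect) (use char_factor_tG[OF f] \<phi>_k' in simp_all)
  then show ?thesis unfolding generates_topology_def using extension_lawvere_tierney f by blast
qed

end

end

theorem proposition4:
  fixes C :: "('o, 'a) precategory" and t k :: 'a and \<E> \<J> \<M> :: "'a set"
    and G :: "('o, 'a, 'o, 'a) functor_data" and \<epsilon> \<delta> :: "'o \<Rightarrow> 'a"
    and m\<^sub>G t\<^sub>G :: "('o, 'a) coalg_arr"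
  defines "C\<^sub>G \<equiv> Coalg C G \<epsilon> \<delta>"
    and "\<E>\<^sub>G \<equiv> left_induced C G \<epsilon> \<delta> \<E>"
    and "\<J>\<^sub>G \<equiv> left_induced C G \<epsilon> \<delta> \<J>"
    and "\<M>\<^sub>G \<equiv> left_induced C G \<epsilon> \<delta> \<M>"
  assumes "topos C" and "subobject_classifier C t"
    and "cartesian_dfs C \<E> \<J> \<M>" and "generates_topology C t \<E> \<J> \<M> k"
    and "cartesian_comonad C G \<epsilon> \<delta>"
    and "continuous_functor C t k G"
    and "ArrMap G ` \<M> \<subseteq> \<M>" and "ArrMap G ` \<J> \<subseteq> \<J>"
    and "is_coalg_omega C G \<epsilon> \<delta> t m\<^sub>G" and "is_coalg_true C G \<epsilon> \<delta> t m\<^sub>G t\<^sub>G"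
  shows "(\<exists>!k\<^sub>G. generates_topology C\<^sub>G t\<^sub>G \<E>\<^sub>G \<J>\<^sub>G \<M>\<^sub>G k\<^sub>G) \<and>
    (\<exists>!k'. is_extension C G \<epsilon> \<delta> m\<^sub>G k k') \<and>
    (\<forall>k\<^sub>G k'. generates_topology C\<^sub>G t\<^sub>G \<E>\<^sub>G \<J>\<^sub>G \<M>\<^sub>G k\<^sub>G \<and> is_extension C G \<epsilon> \<delta> m\<^sub>G k k'
       \<longrightarrow> k\<^sub>G = k')"
proof -
  obtain \<tau> where "m\<^sub>G \<in> Arr (Coalg C G \<epsilon> \<delta>)" "Cod (Coalg C G \<epsilon> \<delta>) m\<^sub>G = cofree G \<delta> (Cod C t)"
    "is_char C t (ArrMap G t) \<tau>"
    "is_equalizer C (Id C (ObjMap G (Cod C t))) (ArrMap G \<tau> \<cdot>\<^bsub>C\<^esub> \<delta> (Cod C t)) (ArrMap Forget m\<^sub>G)"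
    using assms(13) unfolding is_coalg_omega_def by blast
  then interpret topos_dfs_comonad C G \<epsilon> \<delta> \<E> \<J> \<M> t k \<tau> m\<^sub>G t\<^sub>G
    using assms(5-14) by (intro topos_dfs_comonad.intro topos_dfs_comonad_axioms.intro)
  \<comment> \<open>The extension is also the witness that a generated topology exists, so the
    concluding equality is not vacuous.\<close>
  obtain k' where k': "is_extension C G \<epsilon> \<delta> m\<^sub>G k k'"
    using extension_ex1 by blast
  show ?thesis
    unfolding assms(1-4)
  proof (intro conjI allI impI)
    show "\<exists>!k\<^sub>G. generates_topology CG t\<^sub>G (left_induced C G \<epsilon> \<delta> \<E>) (left_induced C G \<epsilon> \<delta> \<J>)
        (left_induced C G \<epsilon> \<delta> \<M>) k\<^sub>G"
      using extension_generated[OF k'] generated_eq_extension[OF k'] by (rule ex1I)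
    show "\<exists>!k'. is_extension C G \<epsilon> \<delta> m\<^sub>G k k'" by (fact extension_ex1)
  qed (blast intro: generated_eq_extension)
qed

end
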